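(* Suppose that $f \in \mathfrak F$ and $\alpha \in \mathbb R\setminus\mathbb Q$, and let $\{a_n/q_n\}_{n=1}^\infty$ be the sequence of best rational approximations to $\alpha$. Let $\mathcal Q_\alpha$ be the set of even denominators $q_n$ such that $q_{n+1} \ge 2q_n$. If the series \[ \sum_{q_n \in \mathcal Q_\alpha} \frac{1}{q_n^2} \int_1^{q_{n+1}} f(x)\,dx \] converges, then so does the series \[ \sum_{n=1}^{\infty} (-1)^n f(n)\,|\sin(n\pi\alpha)|. \]
   Context: $\mathfrak F$ denotes the class of continuous, decreasing functions $f : [1,\infty) \to \mathbb R$ such that $\lim_{x\to\infty} f(x) = 0$ and $\int_1^\infty f(x)\,dx = \infty$. For $\alpha\in\mathbb R$, $\|\alpha\| = \min\{|\alpha - n| : n \in \mathbb Z\}$ denotes the distance from $\alpha$ to the nearest integer. For irrational $\alpha$, the sequence $\{a_n/q_n\}_{n=1}^\infty$ of best rational approximations to $\alpha$ is the unique sequence of rational numbers (with $a_n \in \mathbb Z$ and positive integers $1 = q_1 < q_2 < \cdots$) such that $|q_n\alpha - a_n| = \|q_n\alpha\|$ for all $n$ and, for all $n \ge 2$, \[ \min\{\|q\alpha\| : q\in\mathbb Z,\ 0 < q < q_n\} = \|q_{n-1}\alpha\| > \|q_n\alpha\|. \] The sum over $q_n\in\mathcal Q_\alpha$ runs over the indices $n$ with $q_n$ even and $q_{n+1}\ge 2q_n$ (it may be a finite or empty sum, in which case it converges). *)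

theory Defs
  imports "HOL-Analysis.Analysis"
begin

text \<open>Functions on \<open>[1,\<infinity>)\<close> are total functions on the reals of which only the values on
  \<open>{1..}\<close> matter; ``decreasing'' is meant in the weak sense.\<close>

definition class_F :: "(real \<Rightarrow> real) set" where
  "class_F = {f. continuous_on {1..} f \<and> antimono_on {1..} f \<and> (f \<longlongrightarrow> 0) at_top \<and>
     filterlim (\<lambda>X. integral {1..X} f) at_top at_top}"

definition nint_dist :: "real \<Rightarrow> real" where
  "nint_dist x = (INF n::int. \<bar>x - of_int n\<bar>)"

text \<open>The infimum is attained, so it is the minimum.\<close>

lemma nint_dist_eq_round: "nint_dist x = \<bar>x - of_int (round x)\<bar>"
  unfolding nint_dist_def
proof (rule cInf_eq_minimum)
  show "\<bar>x - of_int (round x)\<bar> \<in> range (\<lambda>n::int. \<bar>x - of_int n\<bar>)" by blast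
  show "\<bar>x - of_int (round x)\<bar> \<le> y" if "y \<in> range (\<lambda>n::int. \<bar>x - of_int n\<bar>)" for y
    using that round_diff_minimal[of x] by auto
qed

text \<open>The sequences are indexed from 1; \<open>a 0\<close> and \<open>q 0\<close> are unconstrained.\<close>

definition best_approximations :: "real \<Rightarrow> (nat \<Rightarrow> int) \<Rightarrow> (nat \<Rightarrow> nat) \<Rightarrow> bool" where
  "best_approximations \<alpha> a q \<longleftrightarrow>
     q 1 = 1 \<and>
     (\<forall>n\<ge>1. q n < q (Suc n)) \<and>
     (\<forall>n\<ge>1. \<bar>real (q n) * \<alpha> - of_int (a n)\<bar> = nint_dist (real (q n) * \<alpha>)) \<and>
     (\<forall>n\<ge>2. Min ((\<lambda>k. nint_dist (real k * \<alpha>)) ` {0<..<q n}) = nint_dist (real (q (n - 1)) * \<alpha>) \<and>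
            nint_dist (real (q (n - 1)) * \<alpha>) > nint_dist (real (q n) * \<alpha>))"

definition even_denoms :: "(nat \<Rightarrow> nat) \<Rightarrow> nat set" where
  "even_denoms q = {q n | n. n \<ge> 1 \<and> even (q n) \<and> q (Suc n) \<ge> 2 * q n}"

end

theory Submission
  imports Defs
begin

text \<open>The Fourier series \<open>\<bar>sin y\<bar> = 2/\<pi> - (4/\<pi>) \<Sum> cos (2 k y) / (4 k\<^sup>2 - 1)\<close> (\<open>abs_sin_Fourier\<close>) turns the partial sums
of the series in question, apart from an alternating series, into combinations with coefficients of order
\<open>1/k\<^sup>2\<close> of the sums \<open>\<Sum> f(n) cos (2 \<pi> n (k \<alpha> + 1/2))\<close>: the sign \<open>(-1) ^ n\<close> shifts \<open>k \<alpha>\<close> by \<open>1/2\<close>. Since \<open>f\<close>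
decreases to 0, each of these sums converges, and if \<open>\<delta>\<^sub>k\<close> is the distance of \<open>k \<alpha> + 1/2\<close> from the nearest
integer, then its partial sums are bounded by twice the sum of the first \<open>\<lceil>1/\<delta>\<^sub>k\<rceil>\<close> values of \<open>f\<close>
(\<open>weighted_cos_sum_bound\<close>). By dominated convergence (\<open>summable_alternating_abs_sin\<close>) it suffices that these
bounds, weighted by \<open>1/k\<^sup>2\<close>, have a finite sum over \<open>k\<close> (\<open>summable_cutoff_weights\<close>).

For this, the frequencies are split into windows \<open>q\<^sub>n < 16 k \<le> q\<^sub>n\<^sub>+\<^sub>1\<close>. In the \<open>n\<close>-th window \<open>\<delta>\<^sub>k\<close> is at least
\<open>1/(8 q\<^sub>n)\<close> unless \<open>2 k\<close> is an odd multiple of \<open>q\<^sub>n\<close> and \<open>q\<^sub>n\<close> is even (\<open>half_dist_lower_nonresonant\<close>).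
The nonresonant \<open>k\<close> are harmless for every \<open>f\<close>: among \<open>q\<^sub>n\<close> consecutive integers the points
\<open>k \<alpha> + 1/2\<close> are separated by \<open>1/(2 q\<^sub>n)\<close> modulo 1, so the \<open>1/\<delta>\<^sub>k\<close> sum to \<open>O(q\<^sub>n sqrt q\<^sub>n)\<close> (\<open>block_sum\<close>), and
the whole window contributes \<open>O(1 / sqrt q\<^sub>n)\<close>. This is summable because the denominators grow
exponentially (\<open>q_growth\<close>). The resonant \<open>k = d q\<^sub>n / 2\<close> have \<open>\<delta>\<^sub>k\<close> of order at least \<open>1 / q\<^sub>n\<^sub>+\<^sub>1\<close>; they contribute
at most a constant times \<open>(1 / q\<^sub>n\<^sup>2) (f(1) + \<integral> f)\<close>, the integral being taken from 1 to \<open>q\<^sub>n\<^sub>+\<^sub>1\<close>, and they exist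
only if \<open>q\<^sub>n\<close> is even and \<open>q\<^sub>n\<^sub>+\<^sub>1 \<ge> 2 q\<^sub>n\<close>. These are the terms of the series assumed to converge.\<close>

section \<open>The Fourier series of the absolute value of the sine\<close>

definition square_wave_sum :: "nat \<Rightarrow> real \<Rightarrow> real" where
  "square_wave_sum K y = (\<Sum>k<K. sin (real (2 * k + 1) * y) / real (2 * k + 1))"

lemma sum_cos_odd_multiples:
  "2 * sin t * (\<Sum>k<K. cos (real (2 * k + 1) * t)) = sin (2 * real K * t)"
proof (induction K)
  case (Suc K)
  have "2 * sin t * cos (real (2 * K + 1) * t) =
      sin (real (2 * K + 1) * t + t) - sin (real (2 * K + 1) * t - t)"
    by (simp add: sin_add sin_diff)
  also have "real (2 * K + 1) * t + t = 2 * real (Suc K) * t"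
    by (simp add: algebra_simps)
  also have "real (2 * K + 1) * t - t = 2 * real K * t"
    by (simp add: algebra_simps)
  finally show ?case
    using Suc by (simp add: algebra_simps)
qed simp

lemma square_wave_sum_at_half_pi: "(\<lambda>K. square_wave_sum K (pi / 2)) \<longlonglongrightarrow> pi / 4"
proof -
  have sin_eq: "sin (real (2 * k + 1) * (pi / 2)) = (-1) ^ k" for k
  proof -
    have "real (2 * k + 1) * (pi / 2) = real k * pi + pi / 2"
      by (simp add: field_simps)
    then show ?thesis
      by (simp only: sin_add sin_npi cos_npi sin_pi_half cos_pi_half mult_zero_right mult_1_right add_0)
  qed
  have "summable (\<lambda>k. (-1) ^ k * (1 / real (k * 2 + 1) * 1 ^ (k * 2 + 1)))"
    by (rule summable_arctan_series) simp
  then have "(\<lambda>k. (-1) ^ k * 1 / real (k * 2 + 1)) sums (pi / 4)"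
    unfolding pi_series by (simp add: summable_sums)
  then show ?thesis
    unfolding sums_def square_wave_sum_def sin_eq by (simp add: mult.commute)
qed

text \<open>The derivative of the partial sum is \<open>sin (2 K t) / (2 sin t)\<close>, which does not become small; its
oscillation does the work. Adding \<open>cos (2 K t) / (4 K sin t)\<close> amounts to one integration by parts: the
correction tends to 0 and the corrected sum has derivative \<open>O(1/K)\<close> away from the zeros of the sine. Hence
the limit is the same at all points of \<open>(0, \<pi>)\<close>, and at \<open>\<pi>/2\<close> it is given by the Leibniz series.\<close>

lemma square_wave_sum_tendsto:
  assumes "0 < y" "y < pi"
  shows "(\<lambda>K. square_wave_sum K y) \<longlonglongrightarrow> pi / 4"
proof -
  define H where "H K t = square_wave_sum K t + cos (2 * real K * t) / (4 * real K * sin t)" for K t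
  have sin_pos: "sin y > 0"
    using assms by (intro sin_gt_zero)
  have sin_ge: "sin y \<le> sin t" if t: "t \<in> closed_segment y (pi / 2)" for t
  proof (cases "y \<le> pi / 2")
    case True
    with t have "y \<le> t" "t \<le> pi / 2" by (auto simp: closed_segment_eq_real_ivl)
    with assms show ?thesis by (intro sin_monotone_2pi_le) auto
  next
    case False
    with t have "pi / 2 \<le> t" "t \<le> y" by (auto simp: closed_segment_eq_real_ivl)
    with assms have "sin (pi - y) \<le> sin (pi - t)" by (intro sin_monotone_2pi_le) auto
    then show ?thesis by simp
  qed
  have deriv: "(H K has_field_derivative - cos (2 * real K * t) * cos t / (4 * real K * (sin t)\<^sup>2))
      (at t within closed_segment y (pi / 2))"
    if t: "t \<in> closed_segment y (pi / 2)" and K: "K > 0" for K t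
  proof -
    have pos: "sin t > 0" using sin_ge[OF t] sin_pos by linarith
    have *: "(\<Sum>k<K. cos (real (2 * k + 1) * t)) = sin (2 * real K * t) / (2 * sin t)"
      using sum_cos_odd_multiples[of t K] pos by (simp add: field_simps)
    have "(square_wave_sum K has_field_derivative (\<Sum>k<K. cos (real (2 * k + 1) * t)))
        (at t within closed_segment y (pi / 2))"
      unfolding square_wave_sum_def[abs_def]
      by (auto intro!: derivative_eq_intros sum.cong simp del: of_nat_add of_nat_mult of_nat_Suc)
    moreover have "((\<lambda>t. cos (2 * real K * t) / (4 * real K * sin t)) has_field_derivative
        (- sin (2 * real K * t) * (2 * real K) * (4 * real K * sin t)
          - cos (2 * real K * t) * (4 * real K * cos t)) / ((4 * real K * sin t) * (4 * real K * sin t)))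
        (at t within closed_segment y (pi / 2))"
      by (rule derivative_eq_intros refl)+ (use pos K in auto)
    ultimately have "(H K has_field_derivative (\<Sum>k<K. cos (real (2 * k + 1) * t)) +
        (- sin (2 * real K * t) * (2 * real K) * (4 * real K * sin t)
          - cos (2 * real K * t) * (4 * real K * cos t)) / ((4 * real K * sin t) * (4 * real K * sin t)))
        (at t within closed_segment y (pi / 2))"
      unfolding H_def[abs_def] by (rule DERIV_add)
    also have "(\<Sum>k<K. cos (real (2 * k + 1) * t)) +
        (- sin (2 * real K * t) * (2 * real K) * (4 * real K * sin t)
          - cos (2 * real K * t) * (4 * real K * cos t)) / ((4 * real K * sin t) * (4 * real K * sin t)) =
        - cos (2 * real K * t) * cos t / (4 * real K * (sin t)\<^sup>2)"
      unfolding * using pos K by (simp add: divide_simps power2_eq_square)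
    finally show ?thesis .
  qed
  have bound: "\<bar>H K y - H K (pi / 2)\<bar> \<le> 1 / (4 * (sin y)\<^sup>2) * \<bar>y - pi / 2\<bar> * inverse (real K)"
    if K: "K > 0" for K
  proof -
    have "norm (H K y - H K (pi / 2)) \<le> 1 / (4 * real K * (sin y)\<^sup>2) * norm (y - pi / 2)"
    proof (rule field_differentiable_bound[of "closed_segment y (pi / 2)"])
      fix t assume t: "t \<in> closed_segment y (pi / 2)"
      show "(H K has_field_derivative - cos (2 * real K * t) * cos t / (4 * real K * (sin t)\<^sup>2))
          (at t within closed_segment y (pi / 2))"
        using deriv[OF t K] .
      have "\<bar>cos (2 * real K * t) * cos t\<bar> \<le> 1"
        by (simp add: abs_mult mult_le_one)
      moreover have "(sin y)\<^sup>2 \<le> (sin t)\<^sup>2"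
        using sin_ge[OF t] sin_pos by (intro power_mono) auto
      ultimately show "norm (- cos (2 * real K * t) * cos t / (4 * real K * (sin t)\<^sup>2))
          \<le> 1 / (4 * real K * (sin y)\<^sup>2)"
        using sin_pos K by (simp add: abs_mult[symmetric] frac_le)
    qed auto
    then show ?thesis by (simp add: field_simps)
  qed
  have inv: "(\<lambda>K. inverse (real K)) \<longlonglongrightarrow> 0"
    by (rule lim_inverse_n)
  have corr: "(\<lambda>K. cos (2 * real K * t) / (4 * real K * sin t)) \<longlonglongrightarrow> 0" if "sin t > 0" for t
  proof (rule Lim_null_comparison)
    show "\<forall>\<^sub>F K in sequentially. norm (cos (2 * real K * t) / (4 * real K * sin t))
        \<le> 1 / (4 * sin t) * inverse (real K)"
      using eventually_gt_at_top[of 0]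
    proof eventually_elim
      case (elim K)
      then show ?case
        using that abs_cos_le_one[of "2 * real K * t"]
        by (simp add: field_simps abs_mult)
    qed
    show "(\<lambda>K. 1 / (4 * sin t) * inverse (real K)) \<longlonglongrightarrow> 0"
      using tendsto_mult_right_zero[OF inv] by blast
  qed
  have "(\<lambda>K. H K y - H K (pi / 2)) \<longlonglongrightarrow> 0"
  proof (rule Lim_null_comparison)
    show "\<forall>\<^sub>F K in sequentially. norm (H K y - H K (pi / 2))
        \<le> 1 / (4 * (sin y)\<^sup>2) * \<bar>y - pi / 2\<bar> * inverse (real K)"
      using eventually_gt_at_top[of 0] by eventually_elim (use bound in auto)
    show "(\<lambda>K. 1 / (4 * (sin y)\<^sup>2) * \<bar>y - pi / 2\<bar> * inverse (real K)) \<longlonglongrightarrow> 0"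
      using tendsto_mult_right_zero[OF inv] by blast
  qed
  moreover have "(\<lambda>K. H K (pi / 2)) \<longlonglongrightarrow> pi / 4 + 0"
    unfolding H_def by (intro tendsto_add square_wave_sum_at_half_pi corr) simp
  ultimately have "(\<lambda>K. (H K y - H K (pi / 2)) + H K (pi / 2)) \<longlonglongrightarrow> 0 + (pi / 4 + 0)"
    by (rule tendsto_add)
  then have "(\<lambda>K. H K y - cos (2 * real K * y) / (4 * real K * sin y)) \<longlonglongrightarrow> pi / 4 - 0"
    by (intro tendsto_diff corr sin_pos) simp
  then show ?thesis
    by (simp add: H_def)
qed

text \<open>Since \<open>2 / (4 k\<^sup>2 - 1) = 1 / (2 k - 1) - 1 / (2 k + 1)\<close>, summation by parts turns the cosine sum into
differences \<open>cos (2 k y) - cos (2 (k - 1) y) = - 2 sin y sin ((2 k - 1) y)\<close>, that is, into a square wave.\<close>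

lemma partial_abs_sin_Fourier:
  "2 * (\<Sum>k<K. cos (2 * real (Suc k) * y) / (4 * (real (Suc k))\<^sup>2 - 1)) =
     1 - 2 * sin y * square_wave_sum K y - cos (2 * real K * y) / (2 * real K + 1)"
proof (induction K)
  case (Suc K)
  define a where "a = 2 * real K + 1"
  have a: "a > 0" by (simp add: a_def)
  have "2 * sin y * sin (a * y) = cos (a * y - y) - cos (a * y + y)"
    by (simp add: cos_add cos_diff)
  also have "a * y - y = 2 * real K * y" by (simp add: a_def algebra_simps)
  also have "a * y + y = 2 * real (Suc K) * y" by (simp add: a_def algebra_simps)
  finally have sin_prod: "2 * sin y * sin (a * y) =
    cos (2 * real K * y) - cos (2 * real (Suc K) * y)" .
  have den: "4 * (real (Suc K))\<^sup>2 - 1 = a * (a + 2)" "2 * real (Suc K) + 1 = a + 2"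
    by (simp_all add: a_def power2_eq_square algebra_simps)
  have wave: "square_wave_sum (Suc K) y = square_wave_sum K y + sin (a * y) / a"
    by (simp add: square_wave_sum_def a_def add.commute)
  define C where "C = cos (2 * real (Suc K) * y)"
  have "2 * (C / (a * (a + 2))) = C / a - C / (a + 2)"
    using a by (simp add: field_simps)
  moreover have "2 * sin y * (sin (a * y) / a) = cos (2 * real K * y) / a - C / a"
    using sin_prod by (simp add: C_def diff_divide_distrib)
  ultimately show ?case
    using Suc unfolding sum.lessThan_Suc wave den C_def[symmetric] a_def[symmetric]
    by (simp add: distrib_left)
qed (simp add: square_wave_sum_def)

text \<open>This is \<open>\<bar>sin y\<bar> = 2/\<pi> - (4/\<pi>) \<Sum> cos (2 k y) / (4 k\<^sup>2 - 1)\<close>. Both sides have period \<open>\<pi>\<close>, so that the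
limit of the square wave on \<open>(0, \<pi>)\<close> suffices.\<close>

lemma abs_sin_Fourier:
  assumes "sin y \<noteq> 0"
  shows "(\<lambda>k. cos (2 * real (Suc k) * y) / (4 * (real (Suc k))\<^sup>2 - 1)) sums (1 / 2 - pi / 4 * \<bar>sin y\<bar>)"
proof -
  have base: "(\<lambda>k. cos (2 * real (Suc k) * y) / (4 * (real (Suc k))\<^sup>2 - 1)) sums (1 / 2 - pi / 4 * sin y)"
    if y: "0 < y" "y < pi" for y
  proof -
    have "(\<lambda>K. cos (2 * real K * y) / (2 * real K + 1)) \<longlonglongrightarrow> 0"
    proof (rule Lim_null_comparison)
      show "\<forall>\<^sub>F K in sequentially. norm (cos (2 * real K * y) / (2 * real K + 1)) \<le> inverse (real (Suc K))"
      proof (intro always_eventually allI)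
        fix K
        have "\<bar>cos (2 * real K * y)\<bar> / (2 * real K + 1) \<le> 1 / real (Suc K)"
          by (intro frac_le) auto
        then show "norm (cos (2 * real K * y) / (2 * real K + 1)) \<le> inverse (real (Suc K))"
          by (simp add: inverse_eq_divide)
      qed
    qed (rule LIMSEQ_inverse_real_of_nat)
    then have "(\<lambda>K. (1 - 2 * sin y * square_wave_sum K y - cos (2 * real K * y) / (2 * real K + 1)) / 2)
        \<longlonglongrightarrow> (1 - 2 * sin y * (pi / 4) - 0) / 2"
      by (intro tendsto_intros square_wave_sum_tendsto y) auto
    then show ?thesis
      unfolding sums_def partial_abs_sin_Fourier[symmetric] by (simp add: field_simps)
  qed
  define m where "m = \<lfloor>y / pi\<rfloor>"
  define x where "x = y - pi * of_int m"
  have y: "y = x + pi * of_int m" by (simp add: x_def)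
  have abs_sin: "\<bar>sin y\<bar> = \<bar>sin x\<bar>"
    by (simp add: y sin_add abs_mult)
  have "x \<ge> 0" "x < pi"
    unfolding x_def m_def using floor_divide_lower[of pi y] floor_divide_upper[of pi y]
    by (auto simp: algebra_simps)
  moreover have "x \<noteq> 0" using abs_sin assms by auto
  ultimately have x: "0 < x" "x < pi" by auto
  have "cos (2 * real k * y) = cos (2 * real k * x)" for k
  proof -
    have "2 * real k * y = 2 * real k * x + 2 * pi * of_int (int k * m)"
      by (simp add: y algebra_simps)
    then show ?thesis by (simp only: cos_add cos_int_2pin sin_int_2pin mult_zero_right diff_0_right mult_1_right)
  qed
  then show ?thesis
    using base[OF x] sin_gt_zero[OF x] unfolding abs_sin by (simp only: abs_of_pos)
qed

section \<open>Cosine sums with monotone weights\<close>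

lemma abel_summation_bound:
  fixes g c :: "nat \<Rightarrow> real"
  assumes anti: "antimono g" and nonneg: "\<And>n. g n \<ge> 0"
    and bound: "\<And>n. \<bar>\<Sum>i<n. c i\<bar> \<le> B"
  shows "\<bar>\<Sum>i<N. g i * c i\<bar> \<le> g 0 * B"
proof -
  have "\<bar>(\<Sum>i<N. g i * c i) - g N * (\<Sum>i<N. c i)\<bar> \<le> (g 0 - g N) * B"
  proof (induction N)
    case (Suc N)
    have "\<bar>(g N - g (Suc N)) * (\<Sum>i<Suc N. c i)\<bar> \<le> (g N - g (Suc N)) * B"
      using bound[of "Suc N"] antimonoD[OF anti, of N "Suc N"]
      by (simp add: abs_mult mult_left_mono del: sum.lessThan_Suc)
    moreover have "(\<Sum>i<Suc N. g i * c i) - g (Suc N) * (\<Sum>i<Suc N. c i) =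
        ((\<Sum>i<N. g i * c i) - g N * (\<Sum>i<N. c i)) + (g N - g (Suc N)) * (\<Sum>i<Suc N. c i)"
      by (simp add: algebra_simps)
    ultimately show ?case
      using Suc by (simp add: algebra_simps abs_le_iff)
  qed simp
  moreover have "\<bar>g N * (\<Sum>i<N. c i)\<bar> \<le> g N * B"
    using bound[of N] nonneg[of N] by (simp add: abs_mult mult_left_mono)
  moreover have "(g 0 - g N) * B + g N * B = g 0 * B"
    by (simp add: algebra_simps)
  ultimately show ?thesis
    by linarith
qed

text \<open>Multiplied by \<open>2 sin t\<close> the sum telescopes.\<close>

lemma cos_sum_bound:
  assumes "sin t \<noteq> 0"
  shows "\<bar>\<Sum>i<N. cos (2 * real (m + i) * t)\<bar> \<le> 1 / \<bar>sin t\<bar>"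
proof -
  have telescope: "2 * sin t * (\<Sum>i<N. cos (2 * real (m + i) * t)) =
      sin ((2 * real (m + N) - 1) * t) - sin ((2 * real m - 1) * t)"
  proof (induction N)
    case (Suc N)
    have "2 * sin t * cos (2 * real (m + N) * t) =
        sin (2 * real (m + N) * t + t) - sin (2 * real (m + N) * t - t)"
      by (simp add: sin_add sin_diff)
    also have "2 * real (m + N) * t + t = (2 * real (m + Suc N) - 1) * t"
      by (simp add: algebra_simps)
    also have "2 * real (m + N) * t - t = (2 * real (m + N) - 1) * t"
      by (simp add: algebra_simps)
    finally show ?case
      using Suc by (simp add: distrib_left)
  qed simp
  have "\<bar>2 * sin t * (\<Sum>i<N. cos (2 * real (m + i) * t))\<bar> \<le> 2"
    unfolding telescope
    using abs_sin_le_one[of "(2 * real (m + N) - 1) * t"] abs_sin_le_one[of "(2 * real m - 1) * t"]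
    by linarith
  then show ?thesis
    using assms by (simp add: abs_mult field_simps)
qed

lemma weighted_cos_sum_tail:
  fixes g :: "nat \<Rightarrow> real"
  assumes anti: "antimono g" and nonneg: "\<And>n. g n \<ge> 0" and sin: "sin t \<noteq> 0"
  shows "\<bar>\<Sum>i<N. g (m + i) * cos (2 * real (Suc (m + i)) * t)\<bar> \<le> g m * (1 / \<bar>sin t\<bar>)"
proof -
  have "antimono (\<lambda>i. g (m + i))"
    using anti by (auto simp: monotone_def)
  from abel_summation_bound[OF this nonneg, of "\<lambda>i. cos (2 * real (Suc m + i) * t)" "1 / \<bar>sin t\<bar>" N]
  show ?thesis
    using cos_sum_bound[OF sin, where m = "Suc m"] by (simp only: add_Suc add_0_right)
qed

text \<open>The first \<open>M\<close> terms are bounded trivially. The remaining ones contribute at most \<open>g M / \<bar>sin t\<bar> \<le> M g M\<close> by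
Abel summation, which the first \<open>M\<close> weights dominate because they are at least \<open>g M\<close>. The bound is
independent of \<open>N\<close>, and depends on \<open>t\<close> only through \<open>M\<close>.\<close>

lemma weighted_cos_sum_bound:
  fixes g :: "nat \<Rightarrow> real"
  assumes anti: "antimono g" and nonneg: "\<And>n. g n \<ge> 0"
    and M: "M > 0" "\<bar>sin t\<bar> \<ge> 1 / real M"
  shows "\<bar>\<Sum>i<N. g i * cos (2 * real (Suc i) * t)\<bar> \<le> 2 * (\<Sum>i<M. g i)"
proof -
  define h where "h i = g i * cos (2 * real (Suc i) * t)" for i
  have head: "\<bar>\<Sum>i<n. h i\<bar> \<le> (\<Sum>i<n. g i)" for n
  proof -
    have "\<bar>h i\<bar> \<le> g i" for i
      using nonneg[of i] abs_cos_le_one[of "2 * real (Suc i) * t"]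
      by (simp add: h_def abs_mult mult_left_le)
    then have "(\<Sum>i<n. \<bar>h i\<bar>) \<le> (\<Sum>i<n. g i)" by (intro sum_mono)
    then show ?thesis using sum_abs[of h "{..<n}"] by linarith
  qed
  show ?thesis
  proof (cases "N \<le> M")
    case True
    have "(\<Sum>i<N. g i) \<le> (\<Sum>i<M. g i)"
      using True nonneg by (intro sum_mono2) auto
    moreover have "(\<Sum>i<M. g i) \<ge> 0" using nonneg by (intro sum_nonneg) auto
    ultimately show ?thesis
      using head[of N] unfolding h_def by linarith
  next
    case False
    then obtain L where L: "N = M + L" by (metis le_iff_add linear)
    have sin: "\<bar>sin t\<bar> > 0" using M by (meson divide_pos_pos less_le_trans of_nat_0_less_iff zero_less_one)
    then have "1 / \<bar>sin t\<bar> \<le> real M"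
      using M by (simp add: field_simps)
    then have "g M * (1 / \<bar>sin t\<bar>) \<le> g M * real M"
      by (intro mult_left_mono nonneg)
    also have "\<dots> = (\<Sum>i<M. g M)" by simp
    also have "\<dots> \<le> (\<Sum>i<M. g i)"
      by (intro sum_mono antimonoD[OF anti]) auto
    finally have "\<bar>\<Sum>i<L. h (M + i)\<bar> \<le> (\<Sum>i<M. g i)"
      using weighted_cos_sum_tail[OF anti nonneg, where t = t and m = M and N = L] sin
      unfolding h_def by linarith
    moreover have "(\<Sum>i<N. h i) = (\<Sum>i<M. h i) + (\<Sum>i<L. h (M + i))"
      unfolding L by (induction L) auto
    ultimately show ?thesis
      using head[of M] unfolding h_def by linarith
  qed
qed

lemma weighted_cos_summable:
  fixes g :: "nat \<Rightarrow> real"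
  assumes anti: "antimono g" and lim: "g \<longlonglongrightarrow> 0" and sin: "sin t \<noteq> 0"
  shows "summable (\<lambda>i. g i * cos (2 * real (Suc i) * t))"
  unfolding summable_Cauchy
proof (intro allI impI)
  fix e :: real assume e: "e > 0"
  have nonneg: "g n \<ge> 0" for n
    by (rule decseq_ge[OF anti lim])
  have "e * \<bar>sin t\<bar> > 0" using e sin by simp
  then have "\<forall>\<^sub>F m in sequentially. g m < e * \<bar>sin t\<bar>"
    using order_tendstoD(2)[OF lim] by blast
  then obtain K where K: "g m < e * \<bar>sin t\<bar>" if "m \<ge> K" for m
    by (auto simp: eventually_sequentially)
  have "norm (\<Sum>i=m..<n. g i * cos (2 * real (Suc i) * t)) < e" if m: "m \<ge> K" for m n
  proof (cases "m \<le> n")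
    case True
    then obtain L where "n = m + L" by (metis le_iff_add)
    then have "(\<Sum>i=m..<n. g i * cos (2 * real (Suc i) * t)) =
        (\<Sum>i<L. g (m + i) * cos (2 * real (Suc (m + i)) * t))"
      using sum.shift_bounds_nat_ivl[of "\<lambda>i. g i * cos (2 * real (Suc i) * t)" 0 m L]
      by (simp only: add_0 add.commute[of m] lessThan_atLeast0)
    also have "\<bar>\<dots>\<bar> \<le> g m * (1 / \<bar>sin t\<bar>)"
      by (rule weighted_cos_sum_tail[OF anti nonneg sin])
    also have "\<dots> < e"
      using K[OF m] sin by (simp add: field_simps)
    finally show ?thesis by simp
  qed (use e in auto)
  then show "\<exists>K. \<forall>m\<ge>K. \<forall>n. norm (\<Sum>i=m..<n. g i * cos (2 * real (Suc i) * t)) < e"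
    by blast
qed

section \<open>Best rational approximations\<close>

lemma nint_dist_le: "nint_dist x \<le> \<bar>x - of_int m\<bar>"
  by (simp add: nint_dist_eq_round round_diff_minimal)

lemma nint_dist_nonneg: "nint_dist x \<ge> 0"
  by (simp add: nint_dist_eq_round)

lemma nint_dist_le_half: "nint_dist x \<le> 1 / 2"
  using of_int_round_abs_le[of x] by (simp add: nint_dist_eq_round abs_minus_commute)

lemma nint_dist_attained: "\<exists>m. nint_dist x = \<bar>x - of_int m\<bar>"
  by (auto simp: nint_dist_eq_round)

locale irrational_best_approximations =
  fixes \<alpha> :: real and a :: "nat \<Rightarrow> int" and q :: "nat \<Rightarrow> nat"
  assumes irrational: "\<alpha> \<notin> \<rat>" and best: "best_approximations \<alpha> a q"
begin

definition err :: "nat \<Rightarrow> real" where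
  "err n = real (q n) * \<alpha> - of_int (a n)"

lemma multiple_neq_int:
  assumes "k > 0"
  shows "real k * \<alpha> \<noteq> of_int m"
proof
  assume "real k * \<alpha> = of_int m"
  then have "\<alpha> = of_int m / real k"
    using assms by (simp add: field_simps)
  moreover have "of_int m / real k \<in> \<rat>" by simp
  ultimately show False using irrational by simp
qed

lemma q_1: "q 1 = 1"
  using best by (simp add: best_approximations_def)

lemma q_less_Suc: "n \<ge> 1 \<Longrightarrow> q n < q (Suc n)"
  using best by (simp add: best_approximations_def)

lemma q_ge: "n \<ge> 1 \<Longrightarrow> q n \<ge> n"
proof (induction n rule: dec_induct)
  case (step n)
  then show ?case using q_less_Suc[of n] by simp
qed (use q_1 in simp)

lemma q_pos: "n \<ge> 1 \<Longrightarrow> q n > 0"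
  using q_ge[of n] by simp

lemma err_nonzero: "n \<ge> 1 \<Longrightarrow> err n \<noteq> 0"
  using multiple_neq_int[OF q_pos, of n "a n"] by (simp add: err_def)

lemma abs_err: "n \<ge> 1 \<Longrightarrow> \<bar>err n\<bar> = nint_dist (real (q n) * \<alpha>)"
  using best by (simp add: best_approximations_def err_def)

lemma abs_err_le_nint_dist:
  assumes "n \<ge> 1" "0 < k" "k < q (Suc n)"
  shows "\<bar>err n\<bar> \<le> nint_dist (real k * \<alpha>)"
proof -
  have "Min ((\<lambda>k. nint_dist (real k * \<alpha>)) ` {0<..<q (Suc n)}) = nint_dist (real (q n) * \<alpha>)"
    using best assms(1) unfolding best_approximations_def
    by (metis Suc_le_mono diff_Suc_1 numeral_2_eq_2 One_nat_def)
  moreover have "Min ((\<lambda>k. nint_dist (real k * \<alpha>)) ` {0<..<q (Suc n)}) \<le> nint_dist (real k * \<alpha>)"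
    using assms by (intro Min_le) auto
  ultimately show ?thesis
    using abs_err[OF assms(1)] by simp
qed

lemma abs_err_less: "n \<ge> 1 \<Longrightarrow> \<bar>err (Suc n)\<bar> < \<bar>err n\<bar>"
  using best abs_err[of n] abs_err[of "Suc n"] unfolding best_approximations_def
  by (metis Suc_le_mono diff_Suc_1 le_SucI numeral_2_eq_2 One_nat_def)

text \<open>Dirichlet's approximation theorem with denominators up to \<open>q (Suc n) - 1\<close> yields some multiple of \<open>\<alpha>\<close> this
close to an integer, and among these denominators \<open>q n\<close> is the best.\<close>

lemma abs_err_upper:
  assumes "n \<ge> 1"
  shows "\<bar>err n\<bar> \<le> 2 / real (q (Suc n))"
proof -
  have q2: "q (Suc n) \<ge> 2"
    using q_pos[OF assms] q_less_Suc[OF assms] by simp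
  then have "q (Suc n) - 1 > 0" by simp
  from Dirichlet_approx[OF this, of \<alpha>] obtain h k where k: "0 < k" "k \<le> int (q (Suc n) - 1)"
    and approx: "\<bar>of_int k * \<alpha> - of_int h\<bar> < 1 / real (q (Suc n) - 1)" by metis
  have "\<bar>err n\<bar> \<le> nint_dist (real (nat k) * \<alpha>)"
    using k q2 by (intro abs_err_le_nint_dist assms) auto
  also have "\<dots> \<le> \<bar>of_int k * \<alpha> - of_int h\<bar>"
    using nint_dist_le[of "real (nat k) * \<alpha>" h] k by simp
  also have "\<dots> \<le> 1 / real (q (Suc n) - 1)" using approx by simp
  also have "\<dots> \<le> 2 / real (q (Suc n))"
    using q2 by (simp add: field_simps of_nat_diff)
  finally show ?thesis .
qed

text \<open>Consecutive approximations \<open>a m / q m\<close> and \<open>a n / q n\<close> are distinct fractions, so that the determinant of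
numerators and denominators is a nonzero integer. Written in terms of the errors, it is at most
\<open>2 * q n * \<bar>err m\<bar>\<close>; and no \<open>k < q n\<close> beats \<open>q m\<close>.\<close>

lemma nint_dist_lower:
  assumes "n \<ge> 1" "0 < k" "k < q n"
  shows "1 / (2 * real (q n)) \<le> nint_dist (real k * \<alpha>)"
proof -
  have "n \<noteq> 1" using assms q_1 by auto
  then obtain m where n: "n = Suc m" and m: "m \<ge> 1"
    using assms(1) by (cases n) auto
  define d where "d = int (q n) * a m - int (q m) * a n"
  have d: "of_int d = real (q m) * err n - real (q n) * err m"
    by (simp add: d_def err_def algebra_simps)
  have less: "q m < q n" "\<bar>err n\<bar> < \<bar>err m\<bar>"
    using q_less_Suc[OF m] abs_err_less[OF m] by (simp_all add: n)
  have "real (q m) * \<bar>err n\<bar> < real (q n) * \<bar>err m\<bar>"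
    using less q_pos[OF m] by (intro mult_strict_mono) auto
  then have "\<bar>real (q m) * err n\<bar> \<noteq> \<bar>real (q n) * err m\<bar>"
    by (simp add: abs_mult)
  then have "d \<noteq> 0" using d by auto
  then have "1 \<le> \<bar>real_of_int d\<bar>" by linarith
  also have "\<dots> \<le> real (q m) * \<bar>err n\<bar> + real (q n) * \<bar>err m\<bar>"
    unfolding d using abs_triangle_ineq4[of "real (q m) * err n" "real (q n) * err m"]
    by (simp add: abs_mult)
  also have "\<dots> \<le> 2 * real (q n) * \<bar>err m\<bar>"
    using \<open>real (q m) * \<bar>err n\<bar> < real (q n) * \<bar>err m\<bar>\<close> by simp
  finally have "1 / (2 * real (q n)) \<le> \<bar>err m\<bar>"
    using assms by (simp add: field_simps)
  also have "\<dots> \<le> nint_dist (real k * \<alpha>)"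
    using assms by (intro abs_err_le_nint_dist m) (auto simp: n)
  finally show ?thesis .
qed

lemma abs_err_le_abs_diff:
  assumes "n \<ge> 1" "q j - q i < q (Suc n)" "q i < q j"
  shows "\<bar>err n\<bar> \<le> \<bar>err j - err i\<bar>"
proof -
  have "\<bar>err n\<bar> \<le> nint_dist (real (q j - q i) * \<alpha>)"
    using assms by (intro abs_err_le_nint_dist) auto
  also have "\<dots> \<le> \<bar>real (q j - q i) * \<alpha> - of_int (a j - a i)\<bar>"
    by (rule nint_dist_le)
  also have "real (q j - q i) * \<alpha> - of_int (a j - a i) = err j - err i"
    using assms by (simp add: err_def of_nat_diff algebra_simps)
  finally show ?thesis .
qed

text \<open>If two consecutive errors had the same sign, then their difference would be smaller than the first of them,
and \<open>q (Suc n) - q n\<close> would be a better denominator than \<open>q n\<close>.\<close>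

lemma err_alternates:
  assumes "n \<ge> 1"
  shows "err n * err (Suc n) < 0"
proof (rule ccontr)
  assume "\<not> err n * err (Suc n) < 0"
  moreover have "err n \<noteq> 0" "err (Suc n) \<noteq> 0"
    using assms by (auto intro!: err_nonzero)
  ultimately have "err n * err (Suc n) > 0" by (simp add: not_less less_le)
  then have "\<bar>err (Suc n) - err n\<bar> < \<bar>err n\<bar>"
    using abs_err_less[OF assms] by (auto simp: zero_less_mult_iff)
  moreover have "\<bar>err n\<bar> \<le> \<bar>err (Suc n) - err n\<bar>"
    using assms q_less_Suc[OF assms] q_pos[OF assms] by (intro abs_err_le_abs_diff) auto
  ultimately show False by simp
qed

text \<open>The errors of \<open>q n\<close> and \<open>q (Suc (Suc n))\<close> have the same sign, so that the difference of these denominators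
is better than \<open>q n\<close> and cannot be less than \<open>q (Suc n)\<close>.\<close>

lemma q_growth:
  assumes "n \<ge> 1"
  shows "q (Suc (Suc n)) \<ge> q (Suc n) + q n"
proof (rule ccontr)
  assume *: "\<not> ?thesis"
  have "err n * err (Suc n) < 0" "err (Suc n) * err (Suc (Suc n)) < 0"
    using assms by (auto intro!: err_alternates)
  then have "err n * err (Suc (Suc n)) > 0"
    by (auto simp: mult_less_0_iff zero_less_mult_iff)
  moreover have "\<bar>err (Suc (Suc n))\<bar> < \<bar>err n\<bar>"
    using abs_err_less[of n] abs_err_less[of "Suc n"] assms by simp
  ultimately have "\<bar>err (Suc (Suc n)) - err n\<bar> < \<bar>err n\<bar>"
    by (auto simp: zero_less_mult_iff)
  moreover have "\<bar>err n\<bar> \<le> \<bar>err (Suc (Suc n)) - err n\<bar>"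
    using assms * q_less_Suc[of n] q_less_Suc[of "Suc n"] by (intro abs_err_le_abs_diff) auto
  ultimately show False by simp
qed

text \<open>By \<open>q_growth\<close> the denominators double every two steps, so \<open>sqrt (q n)\<close> grows at least like the powers of
the fourth root of 2.\<close>

lemma summable_inverse_sqrt_q: "summable (\<lambda>n. 1 / sqrt (real (q (Suc n))))"
proof (rule summable_comparison_test')
  define r :: real where "r = sqrt (sqrt 2)"
  have r: "r > 1" "r\<^sup>2 = sqrt 2" by (simp_all add: r_def)
  show "summable (\<lambda>n. (1 / r) ^ n)"
    using r by (intro summable_geometric) simp
  have "r ^ n \<le> sqrt (real (q (Suc n))) \<and> r ^ Suc n \<le> sqrt (real (q (Suc (Suc n))))" for n
  proof (induction n)
    case 0
    have "r \<le> sqrt 2" unfolding r_def by (intro real_sqrt_le_mono real_le_lsqrt) auto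
    also have "\<dots> \<le> sqrt (real (q 2))" using q_ge[of 2] by simp
    finally show ?case using q_1 by (simp add: numeral_2_eq_2)
  next
    case (Suc n)
    have "r ^ Suc (Suc n) = sqrt 2 * r ^ n" unfolding r(2)[symmetric] by (simp add: power2_eq_square)
    also have "\<dots> \<le> sqrt 2 * sqrt (real (q (Suc n)))" using Suc by (intro mult_left_mono) auto
    also have "\<dots> = sqrt (2 * real (q (Suc n)))" by (simp add: real_sqrt_mult)
    also have "\<dots> \<le> sqrt (real (q (Suc (Suc (Suc n)))))"
      using q_growth[of "Suc n"] q_less_Suc[of "Suc n"] by simp
    finally show ?case using Suc by blast
  qed
  then show "norm (1 / sqrt (real (q (Suc n)))) \<le> (1 / r) ^ n" if "n \<ge> 0" for n
    using r(1) by (auto simp: power_one_over intro!: frac_le)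
qed

end

section \<open>Sums of reciprocals of separated points\<close>

lemma sum_inverse_le_sqrt: "(\<Sum>i<N. 1 / real (Suc i)) \<le> 2 * sqrt (real N)"
proof (induction N)
  case (Suc N)
  define u where "u = sqrt (real N)"
  define v where "v = sqrt (real (Suc N))"
  have uv: "u \<ge> 0" "v \<ge> 1" "u \<le> v" "v * v - u * u = 1" "real (Suc N) = v * v"
    by (simp_all add: u_def v_def)
  have "1 / real (Suc N) \<le> 1 / v"
    using uv by (simp add: frac_le mult_le_cancel_right1)
  also have "\<dots> \<le> 2 * (v - u)"
  proof -
    have "1 = (v - u) * (v + u)" using uv by (simp add: algebra_simps)
    also have "\<dots> \<le> (v - u) * (2 * v)" using uv by (intro mult_left_mono) auto
    finally show ?thesis using uv by (simp add: field_simps)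
  qed
  finally show ?case using Suc by (simp add: u_def v_def)
qed simp

text \<open>At most one of the points lies in each interval of length \<open>1 / (2 Q)\<close>. The sum is therefore at most of order
\<open>Q\<close> times a harmonic sum of length \<open>Q\<close>, and the latter is bounded by a multiple of \<open>sqrt Q\<close>.\<close>

lemma sum_inverse_positive_separated:
  fixes t :: "'b \<Rightarrow> real"
  assumes "finite S" "Q > 0"
    and range: "\<And>k. k \<in> S \<Longrightarrow> t k \<le> 1 / 2 \<and> 1 / (8 * real Q) \<le> t k"
    and sep: "\<And>k l. k \<in> S \<Longrightarrow> l \<in> S \<Longrightarrow> k \<noteq> l \<Longrightarrow> 1 / (2 * real Q) \<le> \<bar>t k - t l\<bar>"
  shows "(\<Sum>k\<in>S. 1 / t k) \<le> 64 * real Q * sqrt (real Q)"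
proof -
  \<comment> \<open>The index of the interval of length \<open>1 / (2 Q)\<close> that contains the point.\<close>
  define j where "j k = nat \<lfloor>2 * real Q * t k\<rfloor>" for k
  have t_pos: "t k > 0" if "k \<in> S" for k
    using range[OF that] \<open>Q > 0\<close> less_le_trans[of 0 "1 / (8 * real Q)" "t k"] by simp
  have j: "real (j k) \<le> 2 * real Q * t k" "2 * real Q * t k < real (j k) + 1" if "k \<in> S" for k
    using t_pos[OF that] by (simp_all add: j_def)
  have j_less: "j k < Suc Q" if "k \<in> S" for k
  proof -
    have "real (j k) \<le> 2 * real Q * (1 / 2)"
      using order_trans[OF j(1)[OF that] mult_left_mono[of "t k" "1 / 2"]] range[OF that] by simp
    then show ?thesis by simp
  qed
  have inj: "inj_on j S"
  proof (rule inj_onI, rule ccontr)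
    fix k l assume kl: "k \<in> S" "l \<in> S" "j k = j l" "k \<noteq> l"
    have "\<bar>2 * real Q * t k - 2 * real Q * t l\<bar> < 1"
      using j[OF kl(1)] j[OF kl(2)] kl(3) by linarith
    then have "2 * real Q * \<bar>t k - t l\<bar> < 1"
      by (simp add: abs_mult flip: right_diff_distrib)
    moreover have "1 \<le> 2 * real Q * \<bar>t k - t l\<bar>"
      using sep[OF kl(1,2,4)] \<open>Q > 0\<close> by (simp add: field_simps)
    ultimately show False by simp
  qed
  have "(\<Sum>k\<in>S. 1 / t k) \<le> (\<Sum>k\<in>S. 16 * real Q * (1 / real (Suc (j k))))"
  proof (rule sum_mono)
    fix k assume k: "k \<in> S"
    have "real (Suc (j k)) \<le> 16 * real Q * t k"
    proof (cases "j k")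
      case 0
      then show ?thesis using range[OF k] \<open>Q > 0\<close> by (simp add: field_simps)
    next
      case (Suc i)
      then show ?thesis using j(1)[OF k] by simp
    qed
    then show "1 / t k \<le> 16 * real Q * (1 / real (Suc (j k)))"
      using t_pos[OF k] by (simp add: field_simps)
  qed
  also have "\<dots> = (\<Sum>i\<in>j ` S. 16 * real Q * (1 / real (Suc i)))"
    by (simp add: sum.reindex[OF inj])
  also have "\<dots> \<le> (\<Sum>i<Suc Q. 16 * real Q * (1 / real (Suc i)))"
    using j_less by (intro sum_mono2) auto
  also have "\<dots> = 16 * real Q * (\<Sum>i<Suc Q. 1 / real (Suc i))"
    by (simp only: sum_distrib_left)
  also have "\<dots> \<le> 16 * real Q * (2 * sqrt (real (Suc Q)))"
    by (intro mult_left_mono sum_inverse_le_sqrt) auto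
  also have "\<dots> \<le> 16 * real Q * (2 * sqrt (4 * real Q))"
    using \<open>Q > 0\<close> by (intro mult_left_mono real_sqrt_le_mono) auto
  also have "\<dots> = 64 * real Q * sqrt (real Q)"
    by (simp add: real_sqrt_mult)
  finally show ?thesis .
qed

lemma sum_inverse_separated:
  fixes t :: "'b \<Rightarrow> real"
  assumes "finite S" "Q > 0"
    and range: "\<And>k. k \<in> S \<Longrightarrow> \<bar>t k\<bar> \<le> 1 / 2 \<and> 1 / (8 * real Q) \<le> \<bar>t k\<bar>"
    and sep: "\<And>k l. k \<in> S \<Longrightarrow> l \<in> S \<Longrightarrow> k \<noteq> l \<Longrightarrow> 1 / (2 * real Q) \<le> \<bar>t k - t l\<bar>"
  shows "(\<Sum>k\<in>S. 1 / \<bar>t k\<bar>) \<le> 128 * real Q * sqrt (real Q)"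
proof -
  let ?P = "{k\<in>S. t k \<ge> 0}" and ?N = "{k\<in>S. \<not> t k \<ge> 0}"
  have "(\<Sum>k\<in>?P. 1 / \<bar>t k\<bar>) \<le> 64 * real Q * sqrt (real Q)"
  proof (rule sum_inverse_positive_separated)
    show "1 / (2 * real Q) \<le> \<bar>\<bar>t k\<bar> - \<bar>t l\<bar>\<bar>" if "k \<in> ?P" "l \<in> ?P" "k \<noteq> l" for k l
      using sep[of k l] that by simp
    show "\<bar>t k\<bar> \<le> 1 / 2 \<and> 1 / (8 * real Q) \<le> \<bar>t k\<bar>" if "k \<in> ?P" for k
      using range[of k] that by blast
  qed (use assms(1,2) in auto)
  moreover have "(\<Sum>k\<in>?N. 1 / \<bar>t k\<bar>) \<le> 64 * real Q * sqrt (real Q)"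
  proof (rule sum_inverse_positive_separated)
    show "1 / (2 * real Q) \<le> \<bar>\<bar>t k\<bar> - \<bar>t l\<bar>\<bar>" if "k \<in> ?N" "l \<in> ?N" "k \<noteq> l" for k l
      using sep[of k l] that by (simp add: abs_minus_commute)
    show "\<bar>t k\<bar> \<le> 1 / 2 \<and> 1 / (8 * real Q) \<le> \<bar>t k\<bar>" if "k \<in> ?N" for k
      using range[of k] that by blast
  qed (use assms(1,2) in auto)
  moreover have "(\<Sum>k\<in>S. 1 / \<bar>t k\<bar>) = (\<Sum>k\<in>?P. 1 / \<bar>t k\<bar>) + (\<Sum>k\<in>?N. 1 / \<bar>t k\<bar>)"
    using assms(1) by (subst sum.union_disjoint[symmetric]) (auto intro!: sum.cong)
  ultimately show ?thesis by simp
qed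

lemma sum_inverse_squares_le:
  assumes "finite S" "inj_on m S"
  shows "(\<Sum>k\<in>S. 1 / (real (m k) + 1)\<^sup>2) \<le> pi\<^sup>2 / 6"
proof -
  have "(\<Sum>k\<in>S. 1 / (real (m k) + 1)\<^sup>2) = (\<Sum>i\<in>m ` S. 1 / (real i + 1)\<^sup>2)"
    using assms by (simp add: sum.reindex)
  also have "\<dots> \<le> (\<Sum>i. 1 / (real i + 1)\<^sup>2)"
    using inverse_squares_sums assms(1) by (intro sum_le_suminf) (auto simp: sums_iff add.commute)
  also have "\<dots> = pi\<^sup>2 / 6"
    using inverse_squares_sums by (simp add: sums_iff add.commute)
  finally show ?thesis .
qed

section \<open>The distance of shifted multiples from the integers\<close>

context irrational_best_approximations
begin

text \<open>The cosine \<open>(-1) ^ n * cos (2 \<pi> k n \<alpha>) = cos (2 \<pi> n (k \<alpha> + 1/2))\<close> of the \<open>k\<close>-th harmonic oscillates fast or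
slowly according to this distance.\<close>

definition half_dist :: "nat \<Rightarrow> real" where
  "half_dist k = nint_dist (real k * \<alpha> + 1 / 2)"

lemma nint_dist_double_le: "nint_dist (real (2 * k) * \<alpha>) \<le> 2 * half_dist k"
proof -
  obtain m where m: "half_dist k = \<bar>real k * \<alpha> + 1 / 2 - of_int m\<bar>"
    unfolding half_dist_def using nint_dist_attained by blast
  have "nint_dist (real (2 * k) * \<alpha>) \<le> \<bar>real (2 * k) * \<alpha> - of_int (2 * m - 1)\<bar>"
    by (rule nint_dist_le)
  also have "real (2 * k) * \<alpha> - of_int (2 * m - 1) = 2 * (real k * \<alpha> + 1 / 2 - of_int m)"
    by (simp add: algebra_simps)
  finally show ?thesis unfolding m by (simp only: abs_mult abs_numeral)
qed

lemma half_dist_pos: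
  assumes "k > 0"
  shows "half_dist k > 0"
proof -
  have "nint_dist (real (2 * k) * \<alpha>) \<noteq> 0"
    using multiple_neq_int[of "2 * k"] assms by (simp add: nint_dist_eq_round)
  then show ?thesis
    using nint_dist_double_le[of k] nint_dist_nonneg[of "real (2 * k) * \<alpha>"] by linarith
qed

lemma half_dist_lower:
  assumes "n \<ge> 1" "0 < k" "2 * k < q n"
  shows "1 / (4 * real (q n)) \<le> half_dist k"
  using nint_dist_lower[of n "2 * k"] nint_dist_double_le[of k] assms by simp

text \<open>These are the frequencies for which \<open>k \<alpha> + 1/2\<close> can be very close to an integer: \<open>2 k \<alpha> = d q n \<alpha>\<close> is
close to \<open>d * a n\<close>, which is odd when \<open>a n\<close> is.\<close>

definition resonant :: "nat \<Rightarrow> nat \<Rightarrow> bool" where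
  "resonant n k \<longleftrightarrow> even (q n) \<and> (\<exists>d. odd d \<and> 2 * k = d * q n)"

text \<open>Write \<open>2 k = d q n + r\<close> with \<open>0 \<le> r < q n\<close>. Up to integers, \<open>2 k \<alpha>\<close> is \<open>r \<alpha> + d err n\<close>, and the
hypothesis \<open>16 k \<le> q (Suc n)\<close> makes the second summand at most half the distance of \<open>r \<alpha>\<close> from the integers
when \<open>r > 0\<close>. If \<open>r = 0\<close>, then \<open>d\<close> is even unless \<open>k\<close> is resonant, and \<open>k \<alpha>\<close> itself is close to an
integer, which puts \<open>k \<alpha> + 1/2\<close> far from all integers.\<close>

lemma half_dist_lower_nonresonant:
  assumes n: "n \<ge> 1" and k: "0 < k" "16 * k \<le> q (Suc n)" and nonres: "\<not> resonant n k"
  shows "1 / (8 * real (q n)) \<le> half_dist k"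
proof -
  define d where "d = 2 * k div q n"
  define r where "r = 2 * k mod q n"
  have div: "2 * k = d * q n + r" by (simp only: d_def r_def div_mult_mod_eq)
  have q: "real (q n) > 0" "real (q (Suc n)) > 0" using q_pos[of n] q_pos[of "Suc n"] n by auto
  have drift: "real d * \<bar>err n\<bar> \<le> 1 / (4 * real (q n))"
  proof -
    have "real (d * q n) \<le> real (2 * k)" unfolding of_nat_le_iff using div by simp
    then have "real d * real (q n) \<le> 2 * real k" by simp
    then have "real d \<le> 2 * real k / real (q n)" using q by (simp add: field_simps)
    then have "real d * \<bar>err n\<bar> \<le> (2 * real k / real (q n)) * (2 / real (q (Suc n)))"
      using abs_err_upper[OF n] by (intro mult_mono) auto
    also have "\<dots> \<le> 1 / (4 * real (q n))"
      using of_nat_mono[OF k(2), where 'a = real] q by (simp add: field_simps)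
    finally show ?thesis .
  qed
  show ?thesis
  proof (cases "r = 0")
    case True
    with div have double: "2 * k = d * q n" by simp
    then have "even (d * q n)" by (metis dvd_triv_left)
    with double nonres have "even d" unfolding resonant_def by auto
    then obtain e where "d = 2 * e" by (elim evenE)
    with True div have k_eq: "k = e * q n" "real d = 2 * real e" by auto
    obtain m where m: "half_dist k = \<bar>real k * \<alpha> + 1 / 2 - of_int m\<bar>"
      unfolding half_dist_def using nint_dist_attained by blast
    have "real k * \<alpha> + 1 / 2 - of_int m = real e * err n + (of_int (int e * a n - m) + 1 / 2)"
      by (simp add: k_eq err_def algebra_simps)
    moreover define z where "z = int e * a n - m"
    moreover have "\<bar>real_of_int z + 1 / 2\<bar> \<ge> 1 / 2"
    proof (cases "z \<ge> 0")
      case False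
      then have "real_of_int z \<le> - 1" by (simp flip: of_int_le_iff)
      then show ?thesis by linarith
    qed simp
    moreover have "\<bar>real e * err n\<bar> \<le> 1 / 8"
    proof -
      have "1 / (4 * real (q n)) \<le> 1 / 4" using q_pos[OF n] by (simp add: field_simps)
      with drift show ?thesis by (simp add: k_eq abs_mult)
    qed
    ultimately have "half_dist k \<ge> 1 / 8" unfolding m by linarith
    moreover have "1 / (8 * real (q n)) \<le> 1 / 8" using q_pos[OF n] by (simp add: field_simps)
    ultimately show ?thesis by linarith
  next
    case False
    obtain m where m: "nint_dist (real (2 * k) * \<alpha>) = \<bar>real (2 * k) * \<alpha> - of_int m\<bar>"
      using nint_dist_attained by blast
    have "r < q n" using q_pos[OF n] by (simp add: r_def)
    with False have "1 / (2 * real (q n)) \<le> nint_dist (real r * \<alpha>)"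
      by (intro nint_dist_lower n) auto
    also have "\<dots> \<le> \<bar>real r * \<alpha> - of_int (m - int d * a n)\<bar>" by (rule nint_dist_le)
    also have "real r * \<alpha> - of_int (m - int d * a n) = (real (2 * k) * \<alpha> - of_int m) - real d * err n"
      unfolding div by (simp add: err_def algebra_simps)
    also have "\<bar>\<dots>\<bar> \<le> nint_dist (real (2 * k) * \<alpha>) + real d * \<bar>err n\<bar>"
      unfolding m using abs_triangle_ineq4[of "real (2 * k) * \<alpha> - of_int m" "real d * err n"]
      by (simp add: abs_mult)
    also have "\<dots> \<le> 2 * half_dist k + 1 / (4 * real (q n))"
      using nint_dist_double_le drift by (intro add_mono)
    finally show ?thesis using q by (simp add: field_simps)
  qed
qed

text \<open>Two elements of a block of length \<open>q n\<close> differ by less than \<open>q n\<close>, so their multiples of \<open>\<alpha>\<close> are separated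
modulo 1 by \<open>1 / (2 * q n)\<close>.\<close>

lemma block_sum:
  assumes n: "n \<ge> 1" and S: "finite S" "\<And>k. k \<in> S \<Longrightarrow> k div q n = m"
    and lower: "\<And>k. k \<in> S \<Longrightarrow> 1 / (8 * real (q n)) \<le> half_dist k"
  shows "(\<Sum>k\<in>S. 1 / half_dist k) \<le> 128 * real (q n) * sqrt (real (q n))"
proof -
  define x where "x k = real k * \<alpha> + 1 / 2" for k
  define t where "t k = x k - of_int (round (x k))" for k
  have abs_t: "half_dist k = \<bar>t k\<bar>" for k
    by (simp add: half_dist_def t_def x_def nint_dist_eq_round)
  have sep: "1 / (2 * real (q n)) \<le> \<bar>t k - t l\<bar>" if kl: "k \<in> S" "l \<in> S" "l < k" for k l
  proof -
    have "k - l < q n"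
    proof -
      have "k = m * q n + k mod q n" "l = m * q n + l mod q n"
        using S(2)[OF kl(1)] S(2)[OF kl(2)] by (metis div_mult_mod_eq)+
      moreover have "k mod q n < q n" using q_pos[OF n] by simp
      ultimately show ?thesis by linarith
    qed
    then have "1 / (2 * real (q n)) \<le> nint_dist (real (k - l) * \<alpha>)"
      using kl by (intro nint_dist_lower n) auto
    also have "\<dots> \<le> \<bar>real (k - l) * \<alpha> - of_int (round (x k) - round (x l))\<bar>"
      by (rule nint_dist_le)
    also have "real (k - l) * \<alpha> - of_int (round (x k) - round (x l)) = t k - t l"
      using kl by (simp add: t_def x_def of_nat_diff algebra_simps)
    finally show ?thesis .
  qed
  show ?thesis
    unfolding abs_t
  proof (rule sum_inverse_separated[OF S(1) q_pos[OF n]])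
    show "\<bar>t k\<bar> \<le> 1 / 2 \<and> 1 / (8 * real (q n)) \<le> \<bar>t k\<bar>" if "k \<in> S" for k
      using lower[OF that] nint_dist_le_half[of "x k"] by (simp add: abs_t[symmetric] half_dist_def x_def)
    show "1 / (2 * real (q n)) \<le> \<bar>t k - t l\<bar>" if "k \<in> S" "l \<in> S" "k \<noteq> l" for k l
      using sep[of k l] sep[of l k] that by (metis abs_minus_commute linorder_neqE_nat)
  qed
qed

end

section \<open>Summation over the frequencies\<close>

lemma sum_lessThan_add_le:
  fixes g :: "nat \<Rightarrow> real"
  assumes "antimono g"
  shows "(\<Sum>i<M + N. g i) \<le> (\<Sum>i<M. g i) + (\<Sum>i<N. g i)"
proof (induction N)
  case (Suc N)
  then show ?case using antimonoD[OF assms, of N "M + N"] by simp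
qed simp

context irrational_best_approximations
begin

text \<open>The windows with \<open>n \<ge> 1\<close> partition the positive integers; in the \<open>n\<close>-th one the approximation \<open>a n / q n\<close> controls
the multiples of \<open>\<alpha>\<close>.\<close>

definition freq_window :: "nat \<Rightarrow> nat set" where
  "freq_window n = {k. q n < 16 * k \<and> 16 * k \<le> q (Suc n)}"

lemma finite_freq_window: "finite (freq_window n)"
  by (rule finite_subset[of _ "{..q (Suc n)}"]) (auto simp: freq_window_def)

text \<open>The window is cut into the blocks of constant \<open>k div q n = m\<close>. On such a block \<open>1 / k\<^sup>2\<close> is of order
\<open>1 / ((m + 1) q n)\<^sup>2\<close> - the lower end of the window takes care of \<open>m = 0\<close> - and the reciprocals of the
distances sum to at most \<open>128 * q n * sqrt (q n)\<close>. The constant is \<open>256 * 128\<close>, and the factor \<open>\<pi>\<^sup>2/6\<close> is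
the sum of the inverse squares over \<open>m\<close>.\<close>

lemma nonresonant_sum:
  assumes n: "n \<ge> 1"
  shows "(\<Sum>k\<in>{k\<in>freq_window n. \<not> resonant n k}. 1 / (real k)\<^sup>2 * (1 / half_dist k))
    \<le> 32768 * (pi\<^sup>2 / 6) * (1 / sqrt (real (q n)))"
proof -
  define S where "S = {k\<in>freq_window n. \<not> resonant n k}"
  define Q where "Q = real (q n)"
  have Q: "Q > 0" using q_pos[OF n] by (simp add: Q_def)
  have S: "finite S" "\<And>k. k \<in> S \<Longrightarrow> k > 0"
    using finite_freq_window[of n] by (auto simp: S_def) (simp add: freq_window_def)
  define B where "B m = {k\<in>S. k div q n = m}" for m
  have block: "(\<Sum>k\<in>B m. 1 / (real k)\<^sup>2 * (1 / half_dist k))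
      \<le> 32768 * (1 / sqrt Q) * (1 / (real m + 1)\<^sup>2)" for m
  proof -
    have weight: "1 / (real k)\<^sup>2 \<le> 256 / ((real m + 1)\<^sup>2 * Q\<^sup>2)" if k: "k \<in> B m" for k
    proof -
      have "(m + 1) * q n \<le> 16 * k"
      proof (cases "m = 0")
        case True
        then show ?thesis using k by (simp add: B_def S_def freq_window_def)
      next
        case False
        then have "(m + 1) * q n \<le> (2 * m) * q n" by (intro mult_right_mono) auto
        also have "\<dots> \<le> 2 * k"
          using k times_div_less_eq_dividend[of "q n" k] by (simp add: B_def mult.commute)
        finally show ?thesis by simp
      qed
      then have "real ((m + 1) * q n) \<le> real (16 * k)" by (simp only: of_nat_le_iff)
      then have "((real m + 1) * Q)\<^sup>2 \<le> (16 * real k)\<^sup>2"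
        using Q by (intro power_mono) (auto simp: Q_def algebra_simps)
      then have "(real m + 1)\<^sup>2 * Q\<^sup>2 \<le> 256 * (real k)\<^sup>2"
        by (simp add: power_mult_distrib)
      moreover have "real k > 0" using k S(2) by (simp add: B_def)
      ultimately show ?thesis using Q by (simp add: divide_simps)
    qed
    have "(\<Sum>k\<in>B m. 1 / (real k)\<^sup>2 * (1 / half_dist k))
        \<le> (\<Sum>k\<in>B m. 256 / ((real m + 1)\<^sup>2 * Q\<^sup>2) * (1 / half_dist k))"
      using half_dist_pos S(2) by (intro sum_mono mult_right_mono weight) (auto simp: B_def less_imp_le)
    also have "\<dots> = 256 / ((real m + 1)\<^sup>2 * Q\<^sup>2) * (\<Sum>k\<in>B m. 1 / half_dist k)"
      by (simp only: sum_distrib_left)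
    also have "\<dots> \<le> 256 / ((real m + 1)\<^sup>2 * Q\<^sup>2) * (128 * Q * sqrt Q)"
    proof (rule mult_left_mono)
      show "(\<Sum>k\<in>B m. 1 / half_dist k) \<le> 128 * Q * sqrt Q"
        unfolding Q_def
      proof (rule block_sum[OF n, where m = m])
        show "1 / (8 * real (q n)) \<le> half_dist k" if "k \<in> B m" for k
          using that S(2) half_dist_lower_nonresonant[OF n, of k]
          by (simp add: B_def S_def freq_window_def)
      qed (use S in \<open>auto simp: B_def\<close>)
    qed simp
    also have "\<dots> = 32768 * (1 / sqrt Q) * (1 / (real m + 1)\<^sup>2)"
    proof -
      define s where "s = sqrt Q"
      have s: "Q = s * s" "s > 0" using Q by (simp_all add: s_def)
      show ?thesis
        unfolding s_def[symmetric] unfolding s(1)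
        using s(2) by (simp add: divide_simps power2_eq_square)
    qed
    finally show ?thesis .
  qed
  have "(\<Sum>k\<in>S. 1 / (real k)\<^sup>2 * (1 / half_dist k)) =
      (\<Sum>m\<in>(\<lambda>k. k div q n) ` S. \<Sum>k\<in>B m. 1 / (real k)\<^sup>2 * (1 / half_dist k))"
    unfolding B_def by (rule sum.image_gen[OF S(1)])
  also have "\<dots> \<le> (\<Sum>m\<in>(\<lambda>k. k div q n) ` S. 32768 * (1 / sqrt Q) * (1 / (real m + 1)\<^sup>2))"
    by (intro sum_mono block)
  also have "\<dots> = 32768 * (1 / sqrt Q) * (\<Sum>m\<in>(\<lambda>k. k div q n) ` S. 1 / (real m + 1)\<^sup>2)"
    by (simp only: sum_distrib_left)
  also have "\<dots> \<le> 32768 * (1 / sqrt Q) * (pi\<^sup>2 / 6)"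
    using sum_inverse_squares_le[of "(\<lambda>k. k div q n) ` S" id] S(1) Q
    by (intro mult_left_mono) auto
  finally show ?thesis unfolding S_def Q_def by (simp only: mult_ac)
qed

text \<open>Here \<open>k = d q n / 2\<close> with \<open>d > 0\<close>, so this is a sum of inverse squares over \<open>d\<close>.\<close>

lemma resonant_sum:
  assumes n: "n \<ge> 1"
  shows "(\<Sum>k\<in>{k\<in>freq_window n. resonant n k}. 1 / (real k)\<^sup>2) \<le> 4 * (pi\<^sup>2 / 6) * (1 / (real (q n))\<^sup>2)"
proof -
  define T where "T = {k\<in>freq_window n. resonant n k}"
  \<comment> \<open>The quotient is at least 1; the shift matches the indexing of the inverse squares from 0.\<close>
  define m where "m k = 2 * k div q n - 1" for k
  have Q: "real (q n) > 0" using q_pos[OF n] by simp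
  have T: "finite T" using finite_freq_window by (simp add: T_def)
  have double: "2 * k = (m k + 1) * q n" if "k \<in> T" for k
  proof -
    have "resonant n k" using that by (simp add: T_def)
    then obtain d where "odd d" "2 * k = d * q n" unfolding resonant_def by (elim conjE exE)
    moreover from \<open>odd d\<close> have "d \<noteq> 0" by (intro notI) simp
    ultimately show ?thesis using q_pos[OF n] by (simp add: m_def)
  qed
  have inj: "inj_on m T"
  proof (rule inj_onI)
    fix k l assume "k \<in> T" "l \<in> T" "m k = m l"
    then have "2 * k = 2 * l" by (simp only: double)
    then show "k = l" by simp
  qed
  have "(\<Sum>k\<in>T. 1 / (real k)\<^sup>2) = (\<Sum>k\<in>T. 4 * (1 / (real (q n))\<^sup>2) * (1 / (real (m k) + 1)\<^sup>2))"
  proof (rule sum.cong)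
    fix k assume "k \<in> T"
    from arg_cong[OF double[OF this], of real]
    have k: "real k = (real (m k) + 1) * real (q n) / 2" by (simp add: algebra_simps)
    show "1 / (real k)\<^sup>2 = 4 * (1 / (real (q n))\<^sup>2) * (1 / (real (m k) + 1)\<^sup>2)"
      unfolding k by (simp add: power_divide power_mult_distrib)
  qed simp
  also have "\<dots> = 4 * (1 / (real (q n))\<^sup>2) * (\<Sum>k\<in>T. 1 / (real (m k) + 1)\<^sup>2)"
    by (simp only: sum_distrib_left)
  also have "\<dots> \<le> 4 * (1 / (real (q n))\<^sup>2) * (pi\<^sup>2 / 6)"
    by (intro mult_left_mono sum_inverse_squares_le T inj) simp
  finally show ?thesis by (simp add: T_def)
qed

text \<open>The number of terms after which the oscillation of the \<open>k\<close>-th cosine takes effect.\<close>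

definition cutoff :: "nat \<Rightarrow> nat" where
  "cutoff k = nat \<lceil>1 / half_dist k\<rceil>"

lemma cutoff_pos:
  assumes "k > 0"
  shows "cutoff k > 0"
  using half_dist_pos[OF assms] by (simp add: cutoff_def)

lemma cutoff_ge:
  assumes "k > 0"
  shows "1 / real (cutoff k) \<le> half_dist k"
proof -
  have "1 / half_dist k \<le> real (cutoff k)" unfolding cutoff_def by (rule real_nat_ceiling_ge)
  then show ?thesis
    using half_dist_pos[OF assms] cutoff_pos[OF assms] by (simp add: field_simps)
qed

lemma cutoff_le:
  assumes "k > 0"
  shows "real (cutoff k) \<le> 2 * (1 / half_dist k)"
proof -
  have "half_dist k \<le> 1 / 2" by (simp only: half_dist_def nint_dist_le_half)
  then have "1 / half_dist k \<ge> 2" using half_dist_pos[OF assms] by (simp add: field_simps)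
  moreover have "real (cutoff k) \<le> 1 / half_dist k + 1"
    using half_dist_pos[OF assms] by (simp add: cutoff_def)
  ultimately show ?thesis by linarith
qed

text \<open>Write \<open>G M\<close> for the sum of the first \<open>M\<close> weights. Nonresonant frequencies are treated with the trivial bound
\<open>G M \<le> M * g 0\<close>. A resonant frequency still has \<open>cutoff k \<le> 4 * q (Suc n)\<close>, because \<open>2 * k < q (Suc n)\<close>, and
\<open>G (4 * M) \<le> 4 * G M\<close> by monotonicity. If the window contains any resonant \<open>k\<close>, then \<open>q n\<close> is even and
\<open>q n \<le> 2 * k \<le> q (Suc n) / 8\<close>; this is why only even denominators followed by a large gap matter.\<close>

lemma window_sum:
  fixes g :: "nat \<Rightarrow> real"
  assumes n: "n \<ge> 1" and anti: "antimono g" and nonneg: "\<And>i. g i \<ge> 0"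
  shows "(\<Sum>k\<in>freq_window n. 1 / (real k)\<^sup>2 * (\<Sum>i<cutoff k. g i)) \<le>
     2 * g 0 * (32768 * (pi\<^sup>2 / 6)) * (1 / sqrt (real (q n))) +
     16 * (pi\<^sup>2 / 6) * (if even (q n) \<and> q (Suc n) \<ge> 2 * q n
        then 1 / (real (q n))\<^sup>2 * (\<Sum>i<q (Suc n). g i) else 0)"
proof -
  define G where "G M = (\<Sum>i<M. g i)" for M
  define S where "S = {k\<in>freq_window n. \<not> resonant n k}"
  define T where "T = {k\<in>freq_window n. resonant n k}"
  have pos: "k > 0" if "k \<in> freq_window n" for k
    using that by (auto simp: freq_window_def)
  have G_linear: "G M \<le> g 0 * real M" for M
    unfolding G_def using sum_bounded_above[of "{..<M}" g "g 0"] antimonoD[OF anti, of 0] by (simp add: mult.commute)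
  have "(\<Sum>k\<in>S. 1 / (real k)\<^sup>2 * G (cutoff k))
      \<le> (\<Sum>k\<in>S. 2 * g 0 * (1 / (real k)\<^sup>2 * (1 / half_dist k)))"
  proof (rule sum_mono)
    fix k assume "k \<in> S"
    then have k: "k > 0" using pos by (simp add: S_def)
    have "G (cutoff k) \<le> g 0 * (2 * (1 / half_dist k))"
      using order_trans[OF G_linear mult_left_mono[OF cutoff_le[OF k] nonneg]] .
    then have "1 / (real k)\<^sup>2 * G (cutoff k) \<le> 1 / (real k)\<^sup>2 * (g 0 * (2 * (1 / half_dist k)))"
      by (intro mult_left_mono) auto
    then show "1 / (real k)\<^sup>2 * G (cutoff k) \<le> 2 * g 0 * (1 / (real k)\<^sup>2 * (1 / half_dist k))"
      by (simp add: mult_ac)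
  qed
  also have "\<dots> = 2 * g 0 * (\<Sum>k\<in>S. 1 / (real k)\<^sup>2 * (1 / half_dist k))"
    by (simp only: sum_distrib_left)
  also have "\<dots> \<le> 2 * g 0 * (32768 * (pi\<^sup>2 / 6) * (1 / sqrt (real (q n))))"
    unfolding S_def using nonneg[of 0] by (intro mult_left_mono nonresonant_sum n) simp
  finally have S_sum: "(\<Sum>k\<in>S. 1 / (real k)\<^sup>2 * G (cutoff k)) \<le>
      2 * g 0 * (32768 * (pi\<^sup>2 / 6)) * (1 / sqrt (real (q n)))" by (simp only: mult.assoc)
  have T_sum: "(\<Sum>k\<in>T. 1 / (real k)\<^sup>2 * G (cutoff k)) \<le>
     16 * (pi\<^sup>2 / 6) * (if even (q n) \<and> q (Suc n) \<ge> 2 * q n then 1 / (real (q n))\<^sup>2 * G (q (Suc n)) else 0)"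
  proof (cases "T = {}")
    case True
    have "G (q (Suc n)) \<ge> 0" unfolding G_def by (intro sum_nonneg nonneg)
    then show ?thesis using True by simp
  next
    case False
    then obtain k where k: "k \<in> T" by blast
    then obtain d where d: "odd d" "2 * k = d * q n" "even (q n)" "16 * k \<le> q (Suc n)"
      by (auto simp: T_def resonant_def freq_window_def)
    have "d \<ge> 1" using d(1) by (cases d) auto
    then have "q n \<le> 2 * k" using d(2) by simp
    with d(4) have large: "q (Suc n) \<ge> 2 * q n" by linarith
    have "G (cutoff k) \<le> 4 * G (q (Suc n))" if "k \<in> T" for k
    proof -
      have k: "k > 0" "2 * k < q (Suc n)" using that pos by (auto simp: T_def freq_window_def)
      have "1 / half_dist k \<le> real (4 * q (Suc n))"
        using half_dist_lower[of "Suc n" k] half_dist_pos[of k] q_pos[of "Suc n"] k by (simp add: field_simps)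
      then have "\<lceil>1 / half_dist k\<rceil> \<le> int (4 * q (Suc n))"
        by (simp add: ceiling_le_iff)
      then have "cutoff k \<le> 4 * q (Suc n)" unfolding cutoff_def by linarith
      then have "G (cutoff k) \<le> G (4 * q (Suc n))"
        unfolding G_def using nonneg by (intro sum_mono2) auto
      also have "4 * q (Suc n) = (q (Suc n) + q (Suc n)) + (q (Suc n) + q (Suc n))" by simp
      also have "G \<dots> \<le> 4 * G (q (Suc n))"
        using sum_lessThan_add_le[OF anti, of "q (Suc n) + q (Suc n)" "q (Suc n) + q (Suc n)"]
          sum_lessThan_add_le[OF anti, of "q (Suc n)" "q (Suc n)"]
        unfolding G_def by linarith
      finally show ?thesis .
    qed
    then have "(\<Sum>k\<in>T. 1 / (real k)\<^sup>2 * G (cutoff k)) \<le> (\<Sum>k\<in>T. 1 / (real k)\<^sup>2 * (4 * G (q (Suc n))))"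
      by (intro sum_mono mult_left_mono) auto
    also have "\<dots> = (\<Sum>k\<in>T. 1 / (real k)\<^sup>2) * (4 * G (q (Suc n)))"
      by (simp only: sum_distrib_right)
    also have "\<dots> \<le> (4 * (pi\<^sup>2 / 6) * (1 / (real (q n))\<^sup>2)) * (4 * G (q (Suc n)))"
      unfolding T_def G_def using nonneg by (intro mult_right_mono resonant_sum n) (simp add: sum_nonneg)
    finally show ?thesis using large d(3) by simp
  qed
  have split: "(\<Sum>k\<in>freq_window n. 1 / (real k)\<^sup>2 * G (cutoff k)) =
      (\<Sum>k\<in>S. 1 / (real k)\<^sup>2 * G (cutoff k)) + (\<Sum>k\<in>T. 1 / (real k)\<^sup>2 * G (cutoff k))"
    unfolding S_def T_def using finite_freq_window[of n]
    by (subst sum.union_disjoint[symmetric]) (auto intro!: sum.cong)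
  show ?thesis
    using add_mono[OF S_sum T_sum] unfolding split[symmetric] unfolding G_def .
qed

lemma summable_cutoff_weights:
  fixes g :: "nat \<Rightarrow> real"
  assumes anti: "antimono g" and nonneg: "\<And>i. g i \<ge> 0"
    and summable: "summable (\<lambda>n. if n \<ge> 1 \<and> even (q n) \<and> q (Suc n) \<ge> 2 * q n
        then 1 / (real (q n))\<^sup>2 * (\<Sum>i<q (Suc n). g i) else 0)"
  shows "summable (\<lambda>k. 1 / (real (Suc k))\<^sup>2 * (\<Sum>i<cutoff (Suc k). g i))"
proof -
  define w where "w k = 1 / (real k)\<^sup>2 * (\<Sum>i<cutoff k. g i)" for k
  define b where "b n = 2 * g 0 * (32768 * (pi\<^sup>2 / 6)) * (1 / sqrt (real (q (Suc n)))) +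
     16 * (pi\<^sup>2 / 6) * (if even (q (Suc n)) \<and> q (Suc (Suc n)) \<ge> 2 * q (Suc n)
        then 1 / (real (q (Suc n)))\<^sup>2 * (\<Sum>i<q (Suc (Suc n)). g i) else 0)" for n
  have w_nonneg: "w k \<ge> 0" for k by (simp add: w_def nonneg sum_nonneg)
  have window: "(\<Sum>k\<in>freq_window (Suc n). w k) \<le> b n" for n
    unfolding w_def b_def by (rule window_sum[OF _ anti nonneg]) simp
  have b_nonneg: "b n \<ge> 0" for n
    using order_trans[OF sum_nonneg[OF w_nonneg] window] .
  have "summable b"
    using summable_Suc_iff[THEN iffD2, OF summable]
    unfolding b_def by (intro summable_add summable_mult summable_inverse_sqrt_q) simp
  have initial: "(\<Sum>k\<in>{k. 0 < k \<and> 16 * k \<le> q (Suc n)}. w k) \<le> (\<Sum>m<n. b m)" for n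
  proof (induction n)
    case 0
    have "{k. 0 < k \<and> 16 * k \<le> q (Suc 0)} = {}" using q_1 by auto
    then show ?case by (simp only: sum.empty lessThan_0 order_refl)
  next
    case (Suc n)
    have "{k. 0 < k \<and> 16 * k \<le> q (Suc (Suc n))} =
        {k. 0 < k \<and> 16 * k \<le> q (Suc n)} \<union> freq_window (Suc n)"
      using q_less_Suc[of "Suc n"] by (auto simp: freq_window_def)
    moreover have "finite {k. 0 < k \<and> 16 * k \<le> q (Suc n)}"
      by (rule finite_subset[of _ "{..q (Suc n)}"]) auto
    moreover have "{k. 0 < k \<and> 16 * k \<le> q (Suc n)} \<inter> freq_window (Suc n) = {}"
      by (auto simp: freq_window_def)
    ultimately have "(\<Sum>k\<in>{k. 0 < k \<and> 16 * k \<le> q (Suc (Suc n))}. w k) =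
        (\<Sum>k\<in>{k. 0 < k \<and> 16 * k \<le> q (Suc n)}. w k) + (\<Sum>k\<in>freq_window (Suc n). w k)"
      by (simp only: sum.union_disjoint[OF _ finite_freq_window])
    then show ?case using Suc window[of n] unfolding sum.lessThan_Suc by linarith
  qed
  have "summable (\<lambda>k. w (Suc k))"
  proof (rule summableI_nonneg_bounded)
    fix N
    have "(\<Sum>k<N. w (Suc k)) = (\<Sum>k\<in>Suc ` {..<N}. w k)"
      by (simp add: sum.reindex)
    also have "\<dots> \<le> (\<Sum>k\<in>{k. 0 < k \<and> 16 * k \<le> q (Suc (16 * N))}. w k)"
    proof (rule sum_mono2)
      show "finite {k. 0 < k \<and> 16 * k \<le> q (Suc (16 * N))}"
        by (rule finite_subset[of _ "{..q (Suc (16 * N))}"]) auto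
      show "Suc ` {..<N} \<subseteq> {k. 0 < k \<and> 16 * k \<le> q (Suc (16 * N))}"
        using q_ge[of "Suc (16 * N)"] by auto
    qed (rule w_nonneg)
    also have "\<dots> \<le> (\<Sum>m<16 * N. b m)" by (rule initial)
    also have "\<dots> \<le> (\<Sum>m. b m)"
      using \<open>summable b\<close> b_nonneg by (intro sum_le_suminf) auto
    finally show "(\<Sum>k<N. w (Suc k)) \<le> (\<Sum>m. b m)" .
  qed (rule w_nonneg)
  then show ?thesis by (simp only: w_def)
qed

end

section \<open>Convergence of the sine series\<close>

text \<open>Modulo integers and up to sign the argument is some \<open>s\<close> in \<open>[0, 1/2]\<close>. For \<open>s \<ge> 1/6\<close> the sine of \<open>\<pi> s\<close>
is at least \<open>1/2\<close>, and below \<open>1/6\<close> its derivative is at least \<open>\<pi>/2\<close>.\<close>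

lemma nint_dist_le_abs_sin: "nint_dist x \<le> \<bar>sin (pi * x)\<bar>"
proof -
  have core: "s \<le> sin (pi * s)" if s: "0 \<le> s" "s \<le> 1 / 2" for s :: real
  proof (cases "s \<le> 1 / 6")
    case False
    have "sin (pi / 6) \<le> sin (pi * s)"
      using s False by (intro sin_monotone_2pi_le) (auto simp: field_simps)
    then show ?thesis using s by (simp add: sin_30)
  next
    case True
    have "sin (pi * 0) - 0 \<le> sin (pi * s) - s"
    proof (rule DERIV_nonneg_imp_nondecreasing[OF s(1)])
      fix u :: real assume u: "0 \<le> u" "u \<le> s"
      have "cos (pi / 3) \<le> cos (pi * u)"
        using u True by (intro cos_monotone_0_pi_le) (auto simp: field_simps)
      then have "pi * (1 / 2) \<le> pi * cos (pi * u)"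
        by (intro mult_left_mono) (simp_all add: cos_60)
      then have "0 \<le> pi * cos (pi * u) - 1" using pi_gt3 by linarith
      moreover have "((\<lambda>s. sin (pi * s) - s) has_real_derivative pi * cos (pi * u) - 1) (at u)"
        by (auto intro!: derivative_eq_intros)
      ultimately show "\<exists>y. ((\<lambda>s. sin (pi * s) - s) has_real_derivative y) (at u) \<and> 0 \<le> y"
        by blast
    qed
    then show ?thesis by simp
  qed
  define s where "s = x - of_int (round x)"
  have "pi * x = pi * s + pi * of_int (round x)"
    by (simp add: s_def algebra_simps)
  then have "\<bar>sin (pi * x)\<bar> = \<bar>sin (pi * s)\<bar>"
    by (simp add: sin_add abs_mult)
  also have "\<dots> = \<bar>sin (pi * \<bar>s\<bar>)\<bar>"
    by (cases "s \<ge> 0") simp_all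
  also have "\<dots> \<ge> \<bar>s\<bar>"
    using core[of "\<bar>s\<bar>"] nint_dist_le_half[of x] by (simp add: s_def nint_dist_eq_round)
  finally show ?thesis by (simp add: s_def nint_dist_eq_round)
qed

lemma class_F_nonneg:
  assumes "f \<in> class_F" "x \<ge> 1"
  shows "f x \<ge> 0"
proof (rule tendsto_upperbound)
  show "(f \<longlongrightarrow> 0) at_top" using assms by (simp add: class_F_def)
  show "\<forall>\<^sub>F y in at_top. f y \<le> f x"
    using eventually_ge_at_top[of x]
    by eventually_elim (use assms in \<open>auto simp: class_F_def monotone_on_def\<close>)
qed simp

lemma class_F_sum_le_integral:
  assumes f: "f \<in> class_F"
  shows "(\<Sum>i<Suc M. f (real (Suc i))) \<le> f 1 + integral {1..real (Suc M)} f"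
proof (induction M)
  case (Suc M)
  have cont: "continuous_on {1..} f" and anti: "antimono_on {1..} f"
    using f by (auto simp: class_F_def)
  have int: "f integrable_on {u..v}" if "u \<ge> 1" for u v
    using that by (intro integrable_continuous_real continuous_on_subset[OF cont]) auto
  have "f (real (Suc (Suc M))) = integral {real (Suc M)..real (Suc (Suc M))} (\<lambda>_. f (real (Suc (Suc M))))"
    by simp
  also have "\<dots> \<le> integral {real (Suc M)..real (Suc (Suc M))} f"
    using anti by (intro integral_le int) (auto simp: monotone_on_def)
  also have "integral {1..real (Suc M)} f + \<dots> = integral {1..real (Suc (Suc M))} f"
    by (intro Henstock_Kurzweil_Integration.integral_combine int) auto
  finally show ?case using Suc by simp
qed simp

lemma integral_class_F_nonneg:
  assumes f: "f \<in> class_F"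
  shows "integral {1..x} f \<ge> 0"
proof (rule Henstock_Kurzweil_Integration.integral_nonneg)
  have "continuous_on {1..} f" using f by (simp add: class_F_def)
  then have "continuous_on {1..x} f" by (rule continuous_on_subset) auto
  then show "f integrable_on {1..x}" by (rule integrable_continuous_real)
qed (use class_F_nonneg[OF f] in auto)

context irrational_best_approximations
begin

lemma summable_even_denoms_sums:
  assumes f: "f \<in> class_F"
    and summable: "summable (\<lambda>n. if n \<ge> 1 \<and> q n \<in> even_denoms q
           then 1 / (real (q n))\<^sup>2 * integral {1..real (q (Suc n))} f else 0)"
  shows "summable (\<lambda>n. if n \<ge> 1 \<and> even (q n) \<and> q (Suc n) \<ge> 2 * q n
        then 1 / (real (q n))\<^sup>2 * (\<Sum>i<q (Suc n). f (real (Suc i))) else 0)" (is "summable ?s")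
proof (rule summable_comparison_test')
  define u where "u n = (if n \<ge> 1 then 1 / (real (q n))\<^sup>2 else 0)" for n
  define v where "v n = (if n \<ge> 1 \<and> q n \<in> even_denoms q
           then 1 / (real (q n))\<^sup>2 * integral {1..real (q (Suc n))} f else 0)" for n
  have "summable (\<lambda>n. u (Suc n))"
  proof (rule summable_comparison_test'[OF summable_inverse_sqrt_q])
    fix n :: nat
    \<comment> \<open>The inverse squares are dominated by the inverse square roots, which are summable by exponential growth.\<close>
    define x where "x = real (q (Suc n))"
    have x: "x \<ge> 1" using q_pos[of "Suc n"] by (simp add: x_def)
    then have "x \<le> (x\<^sup>2)\<^sup>2" using self_le_power[of x 4] by (simp flip: power_mult)
    then have "sqrt x \<le> x\<^sup>2" using x by (intro real_le_lsqrt) auto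
    then show "norm (u (Suc n)) \<le> 1 / sqrt (real (q (Suc n)))"
      using x by (simp add: u_def flip: x_def) (simp add: frac_le)
  qed
  then have "summable u" by (rule summable_Suc_iff[THEN iffD1])
  moreover have "summable v" using summable unfolding v_def .
  ultimately show "summable (\<lambda>n. f 1 * u n + v n)" by (intro summable_add summable_mult)
  fix n :: nat
  have v_nonneg: "v n \<ge> 0"
    using integral_class_F_nonneg[OF f] by (simp add: v_def)
  have f1: "f 1 \<ge> 0" using class_F_nonneg[OF f] by simp
  show "norm (?s n) \<le> f 1 * u n + v n"
  proof (cases "n \<ge> 1 \<and> even (q n) \<and> q (Suc n) \<ge> 2 * q n")
    case True
    then have "q n \<in> even_denoms q" by (auto simp: even_denoms_def)
    with True have uv: "f 1 * u n + v n = 1 / (real (q n))\<^sup>2 * (f 1 + integral {1..real (q (Suc n))} f)"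
      by (simp add: u_def v_def algebra_simps)
    obtain M where M: "q (Suc n) = Suc M" using q_pos[of "Suc n"] by (cases "q (Suc n)") auto
    have "1 / (real (q n))\<^sup>2 * (\<Sum>i<q (Suc n). f (real (Suc i))) \<le> f 1 * u n + v n"
      unfolding uv M by (intro mult_left_mono class_F_sum_le_integral f) simp
    moreover have "1 / (real (q n))\<^sup>2 * (\<Sum>i<q (Suc n). f (real (Suc i))) \<ge> 0"
      using class_F_nonneg[OF f] by (intro mult_nonneg_nonneg sum_nonneg) auto
    ultimately show ?thesis using True by simp
  next
    case False
    have "f 1 * u n + v n \<ge> 0"
      using f1 v_nonneg by (intro add_nonneg_nonneg mult_nonneg_nonneg) (auto simp: u_def)
    then show ?thesis using False by (simp only: if_False norm_zero)
  qed
qed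

text \<open>Expanding \<open>\<bar>sin (n \<pi> \<alpha>)\<bar>\<close> in its Fourier series and interchanging the finite sum over \<open>n\<close> with the series over
the harmonics \<open>k\<close>, each partial sum becomes a series in \<open>k\<close> whose terms converge as the number of summands
grows, and are dominated by the given weights; Tannery's theorem then gives convergence. The constant term
of the Fourier series contributes an alternating series.\<close>

lemma summable_alternating_abs_sin:
  fixes g :: "nat \<Rightarrow> real"
  assumes anti: "antimono g" and lim: "g \<longlonglongrightarrow> 0"
    and weights: "summable (\<lambda>k. 1 / (real (Suc k))\<^sup>2 * (\<Sum>i<cutoff (Suc k). g i))"
  shows "summable (\<lambda>n. (-1) ^ Suc n * g n * \<bar>sin (real (Suc n) * pi * \<alpha>)\<bar>)"
proof -
  define c where "c k = 1 / (4 * (real (Suc k))\<^sup>2 - 1)" for k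
  \<comment> \<open>Half the frequency of the \<open>k\<close>-th harmonic after absorbing the sign \<open>(-1) ^ n\<close>.\<close>
  define t where "t k = pi * (real (Suc k) * \<alpha> + 1 / 2)" for k
  define T where "T k N = (\<Sum>n<N. g n * cos (2 * real (Suc n) * t k))" for k N
  define y where "y n = real (Suc n) * pi * \<alpha>" for n
  have nonneg: "g i \<ge> 0" for i by (rule decseq_ge[OF anti lim])
  have sin_t: "1 / real (cutoff (Suc k)) \<le> \<bar>sin (t k)\<bar>" for k
    using cutoff_ge[of "Suc k"] nint_dist_le_abs_sin[of "real (Suc k) * \<alpha> + 1 / 2"]
    unfolding t_def half_dist_def by simp
  have sin_t_nonzero: "sin (t k) \<noteq> 0" for k
    using sin_t[of k] cutoff_pos[of "Suc k"] by auto
  have c: "0 \<le> c k" "c k \<le> 1 / (real (Suc k))\<^sup>2" for k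
  proof -
    have "(real (Suc k))\<^sup>2 \<ge> 1" by (simp add: one_le_power)
    then have "(real (Suc k))\<^sup>2 \<le> 4 * (real (Suc k))\<^sup>2 - 1" "0 < (real (Suc k))\<^sup>2" by linarith+
    then show "0 \<le> c k" "c k \<le> 1 / (real (Suc k))\<^sup>2" unfolding c_def by (auto intro!: frac_le)
  qed
  have Fourier: "(\<lambda>k. c k * cos (2 * real (Suc n) * t k)) sums
      ((-1) ^ Suc n * (1 / 2 - pi / 4 * \<bar>sin (y n)\<bar>))" for n
  proof -
    have "sin (y n) \<noteq> 0"
    proof
      assume "sin (y n) = 0"
      then obtain i where "real (Suc n) * pi * \<alpha> = of_int i * pi"
        unfolding y_def sin_zero_iff_int2 by blast
      then have "real (Suc n) * \<alpha> = of_int i" by simp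
      then show False using multiple_neq_int[of "Suc n" i] by simp
    qed
    note series = sums_mult[OF abs_sin_Fourier[OF this], of "(-1) ^ Suc n"]
    have flip: "(-1) ^ Suc n * cos (2 * real (Suc k) * y n) = cos (2 * real (Suc n) * t k)" for k
    proof -
      have "2 * real (Suc n) * t k = 2 * real (Suc k) * y n + real (Suc n) * pi"
        by (simp add: t_def y_def algebra_simps)
      then show ?thesis by (simp only: cos_add cos_npi sin_npi) simp
    qed
    have "(-1) ^ Suc n * (cos (2 * real (Suc k) * y n) / (4 * (real (Suc k))\<^sup>2 - 1)) =
        c k * cos (2 * real (Suc n) * t k)" for k
      unfolding times_divide_eq_right flip by (simp only: c_def times_divide_eq_left mult_1_left)
    then show ?thesis using series by (simp only:)
  qed
  have partial: "(\<lambda>k. c k * T k N) sums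
      (\<Sum>n<N. g n * ((-1) ^ Suc n * (1 / 2 - pi / 4 * \<bar>sin (y n)\<bar>)))" for N
  proof -
    have "(\<lambda>k. \<Sum>n<N. g n * (c k * cos (2 * real (Suc n) * t k))) sums
      (\<Sum>n<N. g n * ((-1) ^ Suc n * (1 / 2 - pi / 4 * \<bar>sin (y n)\<bar>)))"
      by (intro sums_sum sums_mult Fourier)
    moreover have "(\<Sum>n<N. g n * (c k * cos (2 * real (Suc n) * t k))) = c k * T k N" for k
      by (simp add: T_def sum_distrib_left mult.left_commute)
    ultimately show ?thesis by simp
  qed
  have "(\<lambda>N. \<Sum>k. c k * T k N) \<longlonglongrightarrow> (\<Sum>k. c k * (\<Sum>n. g n * cos (2 * real (Suc n) * t k)))"
  proof (rule tannerys_theorem[THEN conjunct2, THEN conjunct2])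
    show "(\<lambda>N. c k * T k N) \<longlonglongrightarrow> c k * (\<Sum>n. g n * cos (2 * real (Suc n) * t k))" for k
      unfolding T_def
      by (intro tendsto_mult_left summable_LIMSEQ weighted_cos_summable anti lim sin_t_nonzero)
    have "norm (c k * T k N) \<le> 2 * (1 / (real (Suc k))\<^sup>2 * (\<Sum>i<cutoff (Suc k). g i))" for k N
    proof -
      have "norm (c k * T k N) = c k * \<bar>T k N\<bar>" using c(1)[of k] by (simp add: abs_mult)
      also have "\<dots> \<le> 1 / (real (Suc k))\<^sup>2 * (2 * (\<Sum>i<cutoff (Suc k). g i))"
        unfolding T_def using c[of k]
        by (intro mult_mono weighted_cos_sum_bound anti nonneg sin_t cutoff_pos) auto
      finally show ?thesis by simp
    qed
    then show "\<forall>\<^sub>F (k, N) in sequentially \<times>\<^sub>F sequentially.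
        norm (c k * T k N) \<le> 2 * (1 / (real (Suc k))\<^sup>2 * (\<Sum>i<cutoff (Suc k). g i))"
      by (intro always_eventually) auto
    show "summable (\<lambda>k. 2 * (1 / (real (Suc k))\<^sup>2 * (\<Sum>i<cutoff (Suc k). g i)))"
      by (intro summable_mult weights)
  qed simp
  then have mixed: "summable (\<lambda>n. g n * ((-1) ^ Suc n * (1 / 2 - pi / 4 * \<bar>sin (y n)\<bar>)))"
    unfolding sums_unique[OF partial, symmetric] by (auto simp: summable_def sums_def)
  have "cos (2 * real (Suc n) * (pi / 2)) = (-1) ^ Suc n" for n
  proof -
    have "2 * real (Suc n) * (pi / 2) = real (Suc n) * pi" by simp
    then show ?thesis by (simp only: cos_npi)
  qed
  then have alternating: "summable (\<lambda>n. g n * (-1) ^ Suc n)"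
    using weighted_cos_summable[OF anti lim, of "pi / 2"] by (simp only: sin_pi_half one_neq_zero not_False_eq_True simp_thms)
  \<comment> \<open>Solve for the sine term in the two convergent series.\<close>
  have "summable (\<lambda>n. 4 / pi * (1 / 2 * (g n * (-1) ^ Suc n) -
      g n * ((-1) ^ Suc n * (1 / 2 - pi / 4 * \<bar>sin (y n)\<bar>))))"
    by (intro summable_mult summable_diff mixed alternating)
  moreover have "4 / pi * (1 / 2 * (g n * (-1) ^ Suc n) -
      g n * ((-1) ^ Suc n * (1 / 2 - pi / 4 * \<bar>sin (y n)\<bar>))) = (-1) ^ Suc n * g n * \<bar>sin (y n)\<bar>" for n
    by (simp add: field_simps)
  ultimately show ?thesis unfolding y_def by (simp only:)
qed

end

theorem theorem2:
  fixes f :: "real \<Rightarrow> real" and \<alpha> :: real and a :: "nat \<Rightarrow> int" and q :: "nat \<Rightarrow> nat"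
  assumes "f \<in> class_F"
    and "\<alpha> \<notin> \<rat>"
    and "best_approximations \<alpha> a q"
    and "summable (\<lambda>n. if n \<ge> 1 \<and> q n \<in> even_denoms q
           then 1 / (real (q n))\<^sup>2 * integral {1..real (q (Suc n))} f else 0)"
  shows "summable (\<lambda>n. (-1) ^ Suc n * f (real (Suc n)) * \<bar>sin (real (Suc n) * pi * \<alpha>)\<bar>)"
proof -
  interpret irrational_best_approximations \<alpha> a q
    using assms(2,3) by unfold_locales
  have anti: "antimono (\<lambda>i. f (real (Suc i)))"
    using assms(1) by (auto simp: class_F_def monotone_on_def)
  have lim: "(\<lambda>i. f (real (Suc i))) \<longlonglongrightarrow> 0"
  proof -
    have "(f \<longlongrightarrow> 0) at_top" using assms(1) by (simp add: class_F_def)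
    from filterlim_compose[OF this filterlim_real_sequentially]
    show ?thesis by (rule LIMSEQ_Suc)
  qed
  show ?thesis
    using class_F_nonneg[OF assms(1)]
    by (intro summable_alternating_abs_sin anti lim summable_cutoff_weights
        summable_even_denoms_sums assms(1,4)) auto
qed

end
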